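(* \textsc{Best Red Response} admits an integer linear programming (ILP) formulation with $\mathcal{O}(n\cdot k)$ binary variables and $\mathcal{O}(n\cdot k)$ constraints, where $n$ is the number of targets and $k$ is the number of sensors.
   Context: An Escape Sensing Game (ESG) consists of: a finite set of targets $T=\{t_1,\dots,t_n\}$, each $t_i$ with a value $v_i\in\mathbb{R}^+$; a finite set of sensors $S=\{s_1,\dots,s_k\}$; a recharging time $\tau\in\mathbb{N}\cup\{\infty\}$ common to all sensors; and a sensing matrix $D\in\{0,1\}^{n\times k}$, where $D_{i,j}=1$ means that sensor $s_j$ is capable of sensing target $t_i$. A target ordering is a bijection $\sigma:T\to[n]$. A sensing plan is a map $\psi:S\to 2^T$ with $\psi(s)\cap\psi(s')=\emptyset$ for all $s\neq s'\in S$. The plan $\psi$ is valid with respect to $\sigma$ if (i) for each $s_j\in S$ and $t_i\in\psi(s_j)$ we have $D_{i,j}=1$, and (ii) for each $s\in S$ and all distinct $t,t'\in\psi(s)$ we have $|\sigma(t)-\sigma(t')|>\tau$ (so if $\tau=\infty$ each sensor senses at most one target). The value of not-sensed targets is $v(\psi)=\sum_{t_i\in T\setminus\bigcup_{s\in S}\psi(s)}v_i$. \textsc{Best Red Response}: given an ESG and a target ordering $\sigma$, find a sensing plan $\psi$ that is valid with respect to $\sigma$ and minimizes $v(\psi)$ among all such plans. That the problem admits an ILP formulation of a given size means: from every instance one can construct in polynomial time an integer linear program (linear objective, linear constraints) of that size whose feasible solutions encode the sensing plans valid with respect to $\sigma$, with objective value equal to $v(\psi)$ for the encoded plan $\psi$;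 so its optimal solutions encode the solutions of the instance. *)

theory Defs
  imports
    Complex_Main
    "HOL-Library.Extended_Nat"
    "HOL-Library.FuncSet"
    "HOL-Computational_Algebra.Polynomial"
begin

section \<open>Escape Sensing Games and Best Red Response\<close>

text \<open>Target \<open>t\<^sub>i\<close> and sensor \<open>s\<^sub>j\<close> are represented by their indices, which start at 1.
  The components \<open>target_value\<close> and \<open>sensing\<close> matter only at valid indices.\<close>

record esg =
  num_targets :: nat
  num_sensors :: nat
  target_value :: "nat \<Rightarrow> real"
  recharge :: enat
  sensing :: "nat \<Rightarrow> nat \<Rightarrow> nat"

definition targets :: "esg \<Rightarrow> nat set" where
  "targets G = {1..num_targets G}"

definition sensors :: "esg \<Rightarrow> nat set" where
  "sensors G = {1..num_sensors G}"

definition valid_esg :: "esg \<Rightarrow> bool" where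
  "valid_esg G \<longleftrightarrow>
     (\<forall>i\<in>targets G. target_value G i > 0) \<and>
     (\<forall>i\<in>targets G. \<forall>j\<in>sensors G. sensing G i j \<in> {0, 1})"

definition target_ordering :: "esg \<Rightarrow> (nat \<Rightarrow> nat) \<Rightarrow> bool" where
  "target_ordering G \<sigma> \<longleftrightarrow> bij_betw \<sigma> (targets G) {1..num_targets G}"

definition sensing_plan :: "esg \<Rightarrow> (nat \<Rightarrow> nat set) \<Rightarrow> bool" where
  "sensing_plan G \<psi> \<longleftrightarrow>
     \<psi> \<in> sensors G \<rightarrow>\<^sub>E Pow (targets G) \<and>
     (\<forall>s\<in>sensors G. \<forall>s'\<in>sensors G. s \<noteq> s' \<longrightarrow> \<psi> s \<inter> \<psi> s' = {})"

definition valid_plan :: "esg \<Rightarrow> (nat \<Rightarrow> nat) \<Rightarrow> (nat \<Rightarrow> nat set) \<Rightarrow> bool" where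
  "valid_plan G \<sigma> \<psi> \<longleftrightarrow>
     sensing_plan G \<psi> \<and>
     (\<forall>s\<in>sensors G. \<forall>t\<in>\<psi> s. sensing G t s = 1) \<and>
     (\<forall>s\<in>sensors G. \<forall>t\<in>\<psi> s. \<forall>t'\<in>\<psi> s. t \<noteq> t' \<longrightarrow>
        enat (nat \<bar>int (\<sigma> t) - int (\<sigma> t')\<bar>) > recharge G)"

definition plan_value :: "esg \<Rightarrow> (nat \<Rightarrow> nat set) \<Rightarrow> real" where
  "plan_value G \<psi> = (\<Sum>i\<in>targets G - (\<Union>s\<in>sensors G. \<psi> s). target_value G i)"

definition best_red_response :: "esg \<Rightarrow> (nat \<Rightarrow> nat) \<Rightarrow> (nat \<Rightarrow> nat set) \<Rightarrow> bool" where
  "best_red_response G \<sigma> \<psi> \<longleftrightarrow> is_arg_min (plan_value G) (valid_plan G \<sigma>) \<psi>"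


section \<open>Integer linear programs in binary variables\<close>

text \<open>Minimize \<open>\<Sum>\<^sub>c obj c \<cdot> x c\<close> subject to \<open>\<Sum>\<^sub>c coeff r c \<cdot> x c \<le> rhs r\<close> for every row \<open>r\<close> and
  \<open>x c \<in> {0, 1}\<close> for every column \<open>c\<close>. Rows and columns are numbered from 1. The objective has
  no constant term, an equation counts as two constraints, and the restriction to binary values is
  the only condition not counted by \<open>num_constrs\<close>.\<close>

record ilp =
  num_vars :: nat
  num_constrs :: nat
  obj :: "nat \<Rightarrow> real"
  coeff :: "nat \<Rightarrow> nat \<Rightarrow> int"
  rhs :: "nat \<Rightarrow> int"

definition feasible :: "ilp \<Rightarrow> (nat \<Rightarrow> int) \<Rightarrow> bool" where
  "feasible P x \<longleftrightarrow>
     x \<in> {1..num_vars P} \<rightarrow>\<^sub>E {0, 1} \<and>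
     (\<forall>r\<in>{1..num_constrs P}. (\<Sum>c = 1..num_vars P. coeff P r c * x c) \<le> rhs P r)"

definition objective :: "ilp \<Rightarrow> (nat \<Rightarrow> int) \<Rightarrow> real" where
  "objective P x = (\<Sum>c = 1..num_vars P. obj P c * of_int (x c))"

definition optimal :: "ilp \<Rightarrow> (nat \<Rightarrow> int) \<Rightarrow> bool" where
  "optimal P x \<longleftrightarrow> is_arg_min (objective P) (feasible P) x"


section \<open>A machine model for polynomial time\<close>

text \<open>A random access machine on named two-dimensional arrays of integers and, separately, of real
  numbers; a scalar is the entry at position (0, 0). Integers can be added, subtracted and
  compared. Real numbers are opaque tokens that can only be copied, so the model does not depend
  on how they are represented. Each command takes unit time. As there is no multiplication, the
  bit length of the integers grows by at most a constant (depending on the program) per step, so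
  that polynomially many steps amount to polynomial time also when bit operations are counted.\<close>

datatype aexp =
    Const int
  | Entry string aexp aexp
  | Add aexp aexp
  | Sub aexp aexp

datatype com =
    Skip
  | Assign string aexp aexp aexp  \<comment> \<open>\<open>a[e\<^sub>1, e\<^sub>2] := e\<close>\<close>
  | Copy string aexp aexp string aexp aexp  \<comment> \<open>\<open>a[e\<^sub>1, e\<^sub>2] := b[e\<^sub>3, e\<^sub>4]\<close> for real entries\<close>
  | Then com com
  | IfLess aexp aexp com com
  | WhileLess aexp aexp com

record store =
  ints :: "string \<Rightarrow> int \<Rightarrow> int \<Rightarrow> int"
  reals :: "string \<Rightarrow> int \<Rightarrow> int \<Rightarrow> real"

definition upd :: "(string \<Rightarrow> int \<Rightarrow> int \<Rightarrow> 'a) \<Rightarrow> string \<Rightarrow> int \<Rightarrow> int \<Rightarrow> 'a \<Rightarrow> string \<Rightarrow> int \<Rightarrow> int \<Rightarrow> 'a"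
  where "upd m a i j v = m(a := (m a)(i := (m a i)(j := v)))"

fun aval :: "aexp \<Rightarrow> store \<Rightarrow> int" where
  "aval (Const z) s = z"
| "aval (Entry a e1 e2) s = ints s a (aval e1 s) (aval e2 s)"
| "aval (Add e1 e2) s = aval e1 s + aval e2 s"
| "aval (Sub e1 e2) s = aval e1 s - aval e2 s"

text \<open>\<open>exec c s t s'\<close>: started in store \<open>s\<close>, the program \<open>c\<close> halts after \<open>t\<close> steps in store \<open>s'\<close>.\<close>

inductive exec :: "com \<Rightarrow> store \<Rightarrow> nat \<Rightarrow> store \<Rightarrow> bool" where
  Skip: "exec Skip s 1 s"
| Assign: "exec (Assign a e1 e2 e) s 1
    (s\<lparr>ints := upd (ints s) a (aval e1 s) (aval e2 s) (aval e s)\<rparr>)"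
| Copy: "exec (Copy a e1 e2 b e3 e4) s 1
    (s\<lparr>reals := upd (reals s) a (aval e1 s) (aval e2 s) (reals s b (aval e3 s) (aval e4 s))\<rparr>)"
| Then: "exec c1 s t1 s1 \<Longrightarrow> exec c2 s1 t2 s2 \<Longrightarrow> exec (Then c1 c2) s (t1 + t2) s2"
| IfTrue: "aval e1 s < aval e2 s \<Longrightarrow> exec c1 s t s' \<Longrightarrow> exec (IfLess e1 e2 c1 c2) s (Suc t) s'"
| IfFalse: "\<not> aval e1 s < aval e2 s \<Longrightarrow> exec c2 s t s' \<Longrightarrow> exec (IfLess e1 e2 c1 c2) s (Suc t) s'"
| WhileFalse: "\<not> aval e1 s < aval e2 s \<Longrightarrow> exec (WhileLess e1 e2 c) s 1 s"
| WhileTrue: "aval e1 s < aval e2 s \<Longrightarrow> exec c s t1 s1 \<Longrightarrow> exec (WhileLess e1 e2 c) s1 t2 s2 \<Longrightarrow>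
    exec (WhileLess e1 e2 c) s (Suc (t1 + t2)) s2"


section \<open>Input and output of programs\<close>

text \<open>Memory not occupied by the input is zero. An infinite recharging time is stored as \<open>-1\<close>.\<close>

definition instance_store :: "esg \<Rightarrow> (nat \<Rightarrow> nat) \<Rightarrow> store" where
  "instance_store G \<sigma> = \<lparr>
     ints = (\<lambda>a i j.
       if a = ''n'' \<and> i = 0 \<and> j = 0 then int (num_targets G)
       else if a = ''k'' \<and> i = 0 \<and> j = 0 then int (num_sensors G)
       else if a = ''tau'' \<and> i = 0 \<and> j = 0 then
         (case recharge G of enat \<tau> \<Rightarrow> int \<tau> | \<infinity> \<Rightarrow> - 1)
       else if a = ''sigma'' \<and> i \<in> int ` targets G \<and> j = 0 then int (\<sigma> (nat i))
       else if a = ''D'' \<and> i \<in> int ` targets G \<and> j \<in> int ` sensors G then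
         int (sensing G (nat i) (nat j))
       else 0),
     reals = (\<lambda>a i j.
       if a = ''v'' \<and> i \<in> int ` targets G \<and> j = 0 then target_value G (nat i) else 0)\<rparr>"

definition ilp_of_store :: "store \<Rightarrow> ilp" where
  "ilp_of_store s = \<lparr>
     num_vars = nat (ints s ''N'' 0 0),
     num_constrs = nat (ints s ''M'' 0 0),
     obj = (\<lambda>c. reals s ''c'' (int c) 0),
     coeff = (\<lambda>r c. ints s ''A'' (int r) (int c)),
     rhs = (\<lambda>r. ints s ''b'' (int r) 0)\<rparr>"

definition solution_store :: "esg \<Rightarrow> (nat \<Rightarrow> nat) \<Rightarrow> ilp \<Rightarrow> (nat \<Rightarrow> int) \<Rightarrow> store" where
  "solution_store G \<sigma> P x = (instance_store G \<sigma>)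
     \<lparr>ints := (\<lambda>a i j.
        if a = ''x'' \<and> i \<in> int ` {1..num_vars P} \<and> j = 0 then x (nat i)
        else ints (instance_store G \<sigma>) a i j)\<rparr>"

definition plan_of_store :: "esg \<Rightarrow> store \<Rightarrow> nat \<Rightarrow> nat set" where
  "plan_of_store G s = (\<lambda>j\<in>sensors G. {i \<in> targets G. ints s ''psi'' (int i) (int j) = 1})"


section \<open>ILP formulations of Best Red Response\<close>

text \<open>The time bound is a polynomial in \<open>n + k\<close>. This is a lower bound for the input size, so the
  requirement is at least as strong as polynomial time in the size of the instance.\<close>

definition constructs_ilp :: "com \<Rightarrow> nat poly \<Rightarrow> esg \<Rightarrow> (nat \<Rightarrow> nat) \<Rightarrow> ilp \<Rightarrow> bool" where
  "constructs_ilp build p G \<sigma> P \<longleftrightarrow>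
     (\<exists>t s. exec build (instance_store G \<sigma>) t s \<and>
        t \<le> poly p (num_targets G + num_sensors G) \<and> P = ilp_of_store s)"

text \<open>\<open>dec x\<close> is the sensing plan encoded by the feasible solution \<open>x\<close>. The encoding is
  required to be effective, that is, plans can be recovered from solutions in polynomial time.\<close>

definition computes_decoding ::
  "com \<Rightarrow> nat poly \<Rightarrow> esg \<Rightarrow> (nat \<Rightarrow> nat) \<Rightarrow> ilp \<Rightarrow> ((nat \<Rightarrow> int) \<Rightarrow> nat \<Rightarrow> nat set) \<Rightarrow> bool" where
  "computes_decoding decode p G \<sigma> P dec \<longleftrightarrow>
     (\<forall>x. feasible P x \<longrightarrow>
        (\<exists>t s. exec decode (solution_store G \<sigma> P x) t s \<and>
           t \<le> poly p (num_targets G + num_sensors G) \<and> dec x = plan_of_store G s))"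

definition encodes_best_red_response ::
  "ilp \<Rightarrow> ((nat \<Rightarrow> int) \<Rightarrow> nat \<Rightarrow> nat set) \<Rightarrow> esg \<Rightarrow> (nat \<Rightarrow> nat) \<Rightarrow> bool" where
  "encodes_best_red_response P dec G \<sigma> \<longleftrightarrow>
     dec ` {x. feasible P x} = {\<psi>. valid_plan G \<sigma> \<psi>} \<and>
     (\<forall>x. feasible P x \<longrightarrow> objective P x = plan_value G (dec x)) \<and>
     dec ` {x. optimal P x} = {\<psi>. best_red_response G \<sigma> \<psi>}"

end

theory Submission
  imports Defs
begin

text \<open>Every target occupies exactly one of the slots \<open>0..k\<close>: slot 0 if it is not sensed, slot \<open>j > 0\<close> if
  sensor \<open>j\<close> senses it. One binary variable per pair of target and slot makes the value of the
  plan linear. A sensor respects the recharging time if and only if it senses at most one target in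
  each window of positions \<open>\<sigma> t, \<dots>, \<sigma> t + \<tau>\<close>, because two targets that are too close both lie in
  the window opened by the earlier one; this takes one row per target and sensor. The capability
  constraints need no rows of their own: in the window rows a target gets weight 2 instead of 1 if
  the sensor cannot sense it.\<close>

section \<open>Time-bounded execution\<close>

text \<open>One row per sensor and pair of conflicting targets would mean up to the order of n^2 k
  rows; windows bring this down to order n k, because all conflicts inside a window share one row.
  Weight 2 against the bound 1 forbids a binary variable outright, and since the recharging time is
  nonnegative every target lies in the window that it opens itself, so no variable escapes its
  capability test. Slot 0 is more than bookkeeping: the objective has no constant term and the
  machine can only copy real numbers, so the value of a plan cannot be computed as the total value
  minus the sensed values. With slot 0, every objective coefficient is a copied value or zero. The
  machine also lacks multiplication and division; therefore the number of columns, and the target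
  and slot of each column, are tabulated by counting.\<close>

definition runs :: "com \<Rightarrow> store \<Rightarrow> nat \<Rightarrow> (store \<Rightarrow> bool) \<Rightarrow> bool" where
  "runs c s T Q \<longleftrightarrow> (\<exists>t s'. exec c s t s' \<and> t \<le> T \<and> Q s')"

lemma runs_mono:
  assumes "runs c s T Q" "T \<le> T'" "\<And>s'. Q s' \<Longrightarrow> Q' s'"
  shows "runs c s T' Q'"
  using assms unfolding runs_def by (meson order_trans)

lemma runs_Then:
  assumes "runs c1 s T1 Q1" "\<And>s'. Q1 s' \<Longrightarrow> runs c2 s' T2 Q2"
  shows "runs (Then c1 c2) s (T1 + T2) Q2"
proof -
  obtain t1 s1 where 1: "exec c1 s t1 s1" "t1 \<le> T1" "Q1 s1"
    using assms(1) unfolding runs_def by blast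
  then obtain t2 s2 where 2: "exec c2 s1 t2 s2" "t2 \<le> T2" "Q2 s2"
    using assms(2) unfolding runs_def by blast
  show ?thesis
    unfolding runs_def using exec.Then[OF 1(1) 2(1)] 1(2) 2(2,3) add_mono by blast
qed

text \<open>A rule for counted loops: \<open>Inv\<close> is indexed by the number of completed
  rounds, and \<open>guard\<close> ties the test to that number, so the loop makes exactly
  \<open>m\<close> rounds. Every round pays one step for its test on top of \<open>T\<close>; the
  last step is the failing test. The induction is on the rounds still to come.\<close>

lemma runs_WhileLess:
  assumes "Inv 0 s"
    and body: "\<And>i s. i < m \<Longrightarrow> Inv i s \<Longrightarrow> runs c s T (Inv (Suc i))"
    and guard: "\<And>i s. i \<le> m \<Longrightarrow> Inv i s \<Longrightarrow> aval e1 s < aval e2 s \<longleftrightarrow> i < m"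
  shows "runs (WhileLess e1 e2 c) s (m * Suc T + 1) (Inv m)"
proof -
  have "runs (WhileLess e1 e2 c) s ((m - i) * Suc T + 1) (Inv m)" if "i \<le> m" "Inv i s" for i s
    using that
  proof (induction "m - i" arbitrary: i s)
    case 0
    then have "\<not> aval e1 s < aval e2 s" "i = m"
      using guard by auto
    then show ?case
      unfolding runs_def using exec.WhileFalse 0 by fastforce
  next
    case (Suc d)
    then have less: "i < m" by simp
    then have g: "aval e1 s < aval e2 s"
      using guard Suc.prems by blast
    obtain t1 s1 where 1: "exec c s t1 s1" "t1 \<le> T" "Inv (Suc i) s1"
      using body[OF less Suc.prems(2)] unfolding runs_def by blast
    have "runs (WhileLess e1 e2 c) s1 ((m - Suc i) * Suc T + 1) (Inv m)"
      using Suc.hyps(1)[of "Suc i" s1] Suc.hyps(2) less 1 by auto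
    then obtain t2 s2 where 2: "exec (WhileLess e1 e2 c) s1 t2 s2"
      "t2 \<le> (m - Suc i) * Suc T + 1" "Inv m s2"
      unfolding runs_def by blast
    have "m - i = Suc (m - Suc i)" using less by simp
    then have "Suc (t1 + t2) \<le> (m - i) * Suc T + 1"
      using 1(2) 2(2) by simp
    then show ?case
      unfolding runs_def using exec.WhileTrue[OF g 1(1) 2(1)] 2(3) by blast
  qed
  from this[of 0 s] show ?thesis using assms(1) by simp
qed

section \<open>Symbolic execution of loop-free programs\<close>

fun loop_free :: "com \<Rightarrow> bool" where
  "loop_free (Then c1 c2) \<longleftrightarrow> loop_free c1 \<and> loop_free c2"
| "loop_free (IfLess e1 e2 c1 c2) \<longleftrightarrow> loop_free c1 \<and> loop_free c2"
| "loop_free (WhileLess e1 e2 c) \<longleftrightarrow> False"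
| "loop_free _ \<longleftrightarrow> True"

fun result :: "com \<Rightarrow> store \<Rightarrow> store" where
  "result Skip s = s"
| "result (Assign a e1 e2 e) s =
    s\<lparr>ints := upd (ints s) a (aval e1 s) (aval e2 s) (aval e s)\<rparr>"
| "result (Copy a e1 e2 b e3 e4) s =
    s\<lparr>reals := upd (reals s) a (aval e1 s) (aval e2 s) (reals s b (aval e3 s) (aval e4 s))\<rparr>"
| "result (Then c1 c2) s = result c2 (result c1 s)"
| "result (IfLess e1 e2 c1 c2) s = (if aval e1 s < aval e2 s then result c1 s else result c2 s)"
| "result (WhileLess e1 e2 c) s = s"

text \<open>An overestimate: a conditional is charged for both branches, which keeps the bound a
  plain sum independent of the store. The value for loops, as in \<open>result\<close>, is a dummy
  that \<open>loop_free\<close> excludes.\<close>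

fun cost :: "com \<Rightarrow> nat" where
  "cost (Then c1 c2) = cost c1 + cost c2"
| "cost (IfLess e1 e2 c1 c2) = Suc (cost c1 + cost c2)"
| "cost _ = 1"

text \<open>Turns the inductive \<open>exec\<close> into a computation: the final store becomes a
  term that the simplifier evaluates, so straight-line loop bodies are verified by
  rewriting.\<close>

lemma runs_loop_free:
  assumes "loop_free c" "Q (result c s)" "cost c \<le> T"
  shows "runs c s T Q"
proof -
  have "\<exists>t\<le>cost c. exec c s t (result c s)"
    using assms(1)
  proof (induction c arbitrary: s)
    case (Then c1 c2)
    then obtain t1 t2 where "t1 \<le> cost c1" "exec c1 s t1 (result c1 s)"
      "t2 \<le> cost c2" "exec c2 (result c1 s) t2 (result c2 (result c1 s))"
      by (metis loop_free.simps(1))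
    then show ?case
      by (auto intro!: exI[of _ "t1 + t2"] exec.Then)
  next
    case (IfLess e1 e2 c1 c2)
    then obtain t1 t2 where "t1 \<le> cost c1" "exec c1 s t1 (result c1 s)"
      "t2 \<le> cost c2" "exec c2 s t2 (result c2 s)"
      by (metis loop_free.simps(2))
    then show ?case
      using exec.IfTrue[of e1 s e2 c1 t1 "result c1 s" c2]
        exec.IfFalse[of e1 s e2 c2 t2 "result c2 s" c1]
      by (cases "aval e1 s < aval e2 s") (auto intro: exI[of _ "Suc t1"] exI[of _ "Suc t2"])
  qed (auto intro: exec.intros exI[of _ 1])
  then show ?thesis
    unfolding runs_def using assms(2,3) order_trans by blast
qed

lemma upd_apply:
  "upd m a i j v b p q = (if b = a \<and> p = i \<and> q = j then v else m b p q)"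
  by (simp add: upd_def)

lemma upd_other: "b \<noteq> a \<Longrightarrow> upd m a i j v b = m b"
  by (simp add: upd_def)

abbreviation scalar :: "string \<Rightarrow> aexp" where
  "scalar a \<equiv> Entry a (Const 0) (Const 0)"

abbreviation vec :: "string \<Rightarrow> aexp \<Rightarrow> aexp" where
  "vec a e \<equiv> Entry a e (Const 0)"

abbreviation Set_scalar :: "string \<Rightarrow> aexp \<Rightarrow> com" where
  "Set_scalar a e \<equiv> Assign a (Const 0) (Const 0) e"

abbreviation Set_vec :: "string \<Rightarrow> aexp \<Rightarrow> aexp \<Rightarrow> com" where
  "Set_vec a e1 e \<equiv> Assign a e1 (Const 0) e"

abbreviation incr :: "string \<Rightarrow> com" where
  "incr a \<equiv> Set_scalar a (Add (scalar a) (Const 1))"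

text \<open>The frame condition of the program proofs, with \<open>X\<close> the names of the arrays
  that may have changed. It compares whole arrays, so an untouched array is replaced in one
  rewriting step.\<close>

definition agree_off :: "'a set \<Rightarrow> ('a \<Rightarrow> 'b) \<Rightarrow> ('a \<Rightarrow> 'b) \<Rightarrow> bool" where
  "agree_off X f g \<longleftrightarrow> (\<forall>a. a \<notin> X \<longrightarrow> g a = f a)"

lemma agree_off_refl [simp]: "agree_off X f f"
  by (simp add: agree_off_def)

lemma agree_off_upd [simp]: "a \<in> X \<Longrightarrow> agree_off X f (upd g a i j v) \<longleftrightarrow> agree_off X f g"
  by (auto simp: agree_off_def upd_def)

lemma agree_offD: "agree_off X f g \<Longrightarrow> a \<notin> X \<Longrightarrow> g a = f a"
  by (simp add: agree_off_def)

section \<open>Enumeration of targets and slots\<close>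

text \<open>Column c of target i and slot j satisfies c + k = i (k + 1) + j; the shift by k lets
  targets count from 1 while slots count from 0. The virtual column 0 gets target 0 and slot k, as
  if it closed a block before the first target.\<close>

definition tgt :: "nat \<Rightarrow> nat \<Rightarrow> nat" where
  "tgt k c = (c + k) div Suc k"

definition slot :: "nat \<Rightarrow> nat \<Rightarrow> nat" where
  "slot k c = (c + k) mod Suc k"

definition col :: "nat \<Rightarrow> nat \<Rightarrow> nat \<Rightarrow> nat" where
  "col k i j = (i - 1) * Suc k + Suc j"

lemma tgt_0 [simp]: "tgt k 0 = 0" and slot_0 [simp]: "slot k 0 = k"
  by (simp_all add: tgt_def slot_def)

lemma slot_le: "slot k c \<le> k"
  unfolding slot_def by (simp add: less_Suc_eq_le[symmetric])

text \<open>An odometer: the slot advances up to k, then resets and passes a carry to the target.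
  Started at the virtual column 0, this recurrence replaces division on the machine.\<close>

lemma tgt_Suc: "tgt k (Suc c) = (if slot k c < k then tgt k c else Suc (tgt k c))"
  and slot_Suc: "slot k (Suc c) = (if slot k c < k then Suc (slot k c) else 0)"
proof -
  consider "slot k c < k" | "slot k c = k" using slot_le[of k c] by linarith
  then show "tgt k (Suc c) = (if slot k c < k then tgt k c else Suc (tgt k c))"
    "slot k (Suc c) = (if slot k c < k then Suc (slot k c) else 0)"
    by (cases; simp add: tgt_def slot_def div_Suc mod_Suc)+
qed

lemma tgt_col: "1 \<le> i \<Longrightarrow> j \<le> k \<Longrightarrow> tgt k (col k i j) = i"
  and slot_col: "1 \<le> i \<Longrightarrow> j \<le> k \<Longrightarrow> slot k (col k i j) = j"
proof -
  assume *: "1 \<le> i" "j \<le> k"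
  then have "col k i j + k = i * Suc k + j"
    by (cases i) (auto simp: col_def)
  then show "tgt k (col k i j) = i" "slot k (col k i j) = j"
    using *(2) unfolding tgt_def slot_def by (simp_all only: div_mult_self3 mod_mult_self3) auto
qed

lemma col_in:
  assumes "i \<in> {1..n}" "j \<le> k"
  shows "col k i j \<in> {1..n * Suc k}"
proof -
  have "col k i j \<le> (i - 1) * Suc k + Suc k" using assms by (simp add: col_def)
  also have "\<dots> = i * Suc k" using assms by (cases i) auto
  also have "\<dots> \<le> n * Suc k" using assms by (intro mult_le_mono1) auto
  finally show ?thesis by (simp add: col_def)
qed

lemma tgt_in:
  assumes "c \<in> {1..n * Suc k}"
  shows "tgt k c \<in> {1..n}"
proof -
  have "Suc k div Suc k \<le> tgt k c"
    unfolding tgt_def using assms by (intro div_le_mono) auto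
  moreover have "tgt k c < Suc n"
    unfolding tgt_def using assms by (intro less_mult_imp_div_less) auto
  ultimately show ?thesis by simp
qed

lemma col_tgt_slot:
  assumes "1 \<le> c"
  shows "col k (tgt k c) (slot k c) = c"
proof -
  have "Suc k div Suc k \<le> tgt k c"
    unfolding tgt_def using assms by (intro div_le_mono) auto
  then obtain m where m: "tgt k c = Suc m" by (cases "tgt k c") auto
  have "tgt k c * Suc k + slot k c = c + k"
    unfolding tgt_def slot_def by (rule div_mult_mod_eq)
  then show ?thesis unfolding m by (simp add: col_def)
qed

lemma bij_betw_col:
  "bij_betw (\<lambda>(i, j). col k i j) ({1..n} \<times> {0..k}) {1..n * Suc k}"
  by (rule bij_betw_byWitness[where f' = "\<lambda>c. (tgt k c, slot k c)"])
    (use tgt_in[of _ n k] col_in[of _ n _ k] slot_le in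
      \<open>fastforce simp: tgt_col slot_col col_tgt_slot simp del: mult_Suc_right\<close>)+

lemma sum_cols: "(\<Sum>c = 1..n * Suc k. f c) = (\<Sum>i = 1..n. \<Sum>j = 0..k. f (col k i j))"
proof -
  have "(\<Sum>c = 1..n * Suc k. f c) = (\<Sum>p\<in>{1..n} \<times> {0..k}. f (case p of (i, j) \<Rightarrow> col k i j))"
    by (rule sum.reindex_bij_betw[OF bij_betw_col, symmetric])
  also have "\<dots> = (\<Sum>i = 1..n. \<Sum>j = 0..k. f (col k i j))"
    by (simp add: sum.cartesian_product split_def)
  finally show ?thesis .
qed

section \<open>The integer program\<close>

text \<open>All terms are nonnegative, so a selected item of weight 2, or any two selected items,
  already exceed the bound 1. Conversely, a single selected item of weight 1 is the only nonzero
  term.\<close>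

lemma packing_row:
  fixes a x :: "'a \<Rightarrow> int"
  assumes "finite A" "\<And>i. i \<in> A \<Longrightarrow> a i \<in> {1, 2}" "\<And>i. i \<in> A \<Longrightarrow> x i \<in> {0, 1}"
  shows "(\<Sum>i\<in>A. a i * x i) \<le> 1 \<longleftrightarrow>
    (\<forall>i\<in>A. x i = 1 \<longrightarrow> a i = 1) \<and> (\<forall>i\<in>A. \<forall>i'\<in>A. x i = 1 \<longrightarrow> x i' = 1 \<longrightarrow> i = i')"
    (is "?L \<longleftrightarrow> ?R")
proof
  assume L: ?L
  have nonneg: "0 \<le> a i * x i" if "i \<in> A" for i
    using assms(2,3)[OF that] by auto
  have "a i = 1" if "i \<in> A" "x i = 1" for i
    using member_le_sum[of i A "\<lambda>i. a i * x i"] nonneg assms(1) assms(2)[of i] that L by fastforce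
  moreover have "i = i'" if i: "i \<in> A" "i' \<in> A" "x i = 1" "x i' = 1" for i i'
  proof (rule ccontr)
    assume "i \<noteq> i'"
    have "(\<Sum>l\<in>{i, i'}. a l * x l) \<le> (\<Sum>l\<in>A. a l * x l)"
      using i nonneg assms(1) by (intro sum_mono2) auto
    then show False
      using \<open>i \<noteq> i'\<close> i assms(2)[of i] assms(2)[of i'] L by auto
  qed
  ultimately show ?R by blast
next
  assume R: ?R
  show ?L
  proof (cases "\<exists>i\<in>A. x i = 1")
    case True
    then obtain i where i: "i \<in> A" "x i = 1" by blast
    have "(\<Sum>l\<in>A. a l * x l) = (\<Sum>l\<in>{i}. a l * x l)"
    proof (rule sum.mono_neutral_right)
      show "\<forall>l\<in>A - {i}. a l * x l = 0"
      proof
        fix l assume "l \<in> A - {i}"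
        then have "x l \<noteq> 1" "x l \<in> {0, 1}" using R i assms(3) by blast+
        then show "a l * x l = 0" by simp
      qed
    qed (use i assms(1) in auto)
    then show ?thesis using i R by simp
  next
    case False
    then have "x i = 0" if "i \<in> A" for i
      using assms(3)[OF that] that by auto
    then show ?thesis by simp
  qed
qed

text \<open>The two inequalities together say that the sum equals 1: the negated one yields a
  selected index, and \<open>packing_row\<close> with all weights 1 yields its uniqueness.\<close>

lemma partition_row:
  fixes x :: "'a \<Rightarrow> int"
  assumes "finite A" "\<And>i. i \<in> A \<Longrightarrow> x i \<in> {0, 1}"
  shows "(\<Sum>i\<in>A. x i) \<le> 1 \<and> (\<Sum>i\<in>A. - x i) \<le> - 1 \<longleftrightarrow> (\<exists>!i. i \<in> A \<and> x i = 1)"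
proof -
  have "(\<Sum>i\<in>A. x i) \<ge> 1 \<longleftrightarrow> (\<exists>i\<in>A. x i = 1)"
  proof
    assume *: "(\<Sum>i\<in>A. x i) \<ge> 1"
    show "\<exists>i\<in>A. x i = 1"
    proof (rule ccontr)
      assume "\<not> ?thesis"
      then have "x i = 0" if "i \<in> A" for i
        using assms(2) that by blast
      with * show False by simp
    qed
  next
    assume "\<exists>i\<in>A. x i = 1"
    then obtain i where "i \<in> A" "x i = 1" by blast
    then show "(\<Sum>i\<in>A. x i) \<ge> 1"
      using member_le_sum[of i A x] assms by fastforce
  qed
  moreover have "(\<Sum>i\<in>A. x i) \<le> 1 \<longleftrightarrow> (\<forall>i\<in>A. \<forall>i'\<in>A. x i = 1 \<longrightarrow> x i' = 1 \<longrightarrow> i = i')"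
    using packing_row[of A "\<lambda>_. 1" x] assms by simp
  ultimately show ?thesis by (auto simp: sum_negf)
qed

text \<open>An infinite recharging time becomes n: positions lie in 1..n, so no distance between two
  of them exceeds n, just as none exceeds infinity. This keeps all row conditions within the
  integers.\<close>

definition window :: "esg \<Rightarrow> int" where
  "window G = (case recharge G of enat \<tau> \<Rightarrow> int \<tau> | \<infinity> \<Rightarrow> int (num_targets G))"

lemma recharged_iff:
  assumes "target_ordering G \<sigma>" "t \<in> targets G" "t' \<in> targets G"
  shows "enat (nat \<bar>int (\<sigma> t) - int (\<sigma> t')\<bar>) > recharge G \<longleftrightarrow>
    \<bar>int (\<sigma> t) - int (\<sigma> t')\<bar> > window G"
proof -
  have "\<sigma> t \<in> {1..num_targets G}" "\<sigma> t' \<in> {1..num_targets G}"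
    using assms unfolding target_ordering_def bij_betw_def by auto
  then show ?thesis
    unfolding window_def by (cases "recharge G") auto
qed

text \<open>With \<open>N = n (k + 1)\<close>, rows \<open>1..N\<close> with slot 0 and rows \<open>N+1..2N\<close> (each of the latter repeated for
  all slots, which spares the program a case distinction) force exactly one slot per target. A row
  with slot \<open>j > 0\<close> is the window row of sensor \<open>j\<close> that opens at its target.\<close>

definition window_coeff :: "esg \<Rightarrow> (nat \<Rightarrow> nat) \<Rightarrow> nat \<Rightarrow> nat \<Rightarrow> nat \<Rightarrow> nat \<Rightarrow> int" where
  "window_coeff G \<sigma> i j i' j' =
    (if j = 0 then of_bool (i' = i)
     else if j' = j \<and> \<sigma> i \<le> \<sigma> i' \<and> int (\<sigma> i') - int (\<sigma> i) \<le> window G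
     then 2 - int (sensing G i' j') else 0)"

text \<open>A predicate rather than a concrete record, because the program is specified only on the
  entries that \<open>feasible\<close> and \<open>objective\<close> read; memory outside these rows
  and columns is left open.\<close>

definition slot_ilp :: "esg \<Rightarrow> (nat \<Rightarrow> nat) \<Rightarrow> ilp \<Rightarrow> bool" where
  "slot_ilp G \<sigma> P \<longleftrightarrow> (let k = num_sensors G; N = num_targets G * Suc k in
     num_vars P = N \<and> num_constrs P = N + N \<and>
     (\<forall>c\<in>{1..N}. obj P c = (if slot k c = 0 then target_value G (tgt k c) else 0)) \<and>
     (\<forall>r\<in>{1..N}. rhs P r = 1 \<and> rhs P (N + r) = - 1 \<and>
       (\<forall>c\<in>{1..N}. coeff P r c = window_coeff G \<sigma> (tgt k r) (slot k r) (tgt k c) (slot k c) \<and>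
          coeff P (N + r) c = - of_bool (tgt k c = tgt k r))))"

definition plan_of :: "esg \<Rightarrow> (nat \<Rightarrow> int) \<Rightarrow> nat \<Rightarrow> nat set" where
  "plan_of G x = (\<lambda>j\<in>sensors G. {i\<in>targets G. x (col (num_sensors G) i j) = 1})"

section \<open>Feasible solutions correspond to valid plans of the same value\<close>

locale slot_formulation =
  fixes G :: esg and \<sigma> :: "nat \<Rightarrow> nat" and P :: ilp
  assumes esg: "valid_esg G" and ordering: "target_ordering G \<sigma>" and ilp: "slot_ilp G \<sigma> P"
begin

abbreviation (input) "n \<equiv> num_targets G"
abbreviation (input) "k \<equiv> num_sensors G"

lemma ball_cols: "(\<forall>c\<in>{1..n * Suc k}. Q c) \<longleftrightarrow> (\<forall>i\<in>targets G. \<forall>j\<in>{0..k}. Q (col k i j))"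
proof -
  have "{1..n * Suc k} = (\<lambda>(i, j). col k i j) ` (targets G \<times> {0..k})"
    using bij_betw_imp_surj_on[OF bij_betw_col[of k n]] by (simp add: targets_def)
  then show ?thesis by (simp only: ball_simps split_paired_Ball_Sigma prod.case)
qed

lemma ball_rows:
  "(\<forall>r\<in>{1..num_constrs P}. Q r) \<longleftrightarrow> (\<forall>r\<in>{1..n * Suc k}. Q r \<and> Q (n * Suc k + r))"
proof -
  have "{1..n * Suc k + n * Suc k} = {1..n * Suc k} \<union> (\<lambda>r. n * Suc k + r) ` {1..n * Suc k}"
    by (auto simp: image_iff)
  moreover have "num_constrs P = n * Suc k + n * Suc k"
    using ilp unfolding slot_ilp_def Let_def by blast
  ultimately show ?thesis by (simp only: ball_Un ball_simps) blast
qed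

lemma sum_slot0_row:
  assumes "i \<in> targets G"
  shows "(\<Sum>i' = 1..n. \<Sum>j = 0..k. of_bool (i' = i) * x (col k i' j)) = (\<Sum>j = 0..k. x (col k i j) :: int)"
proof -
  have "(\<Sum>i' = 1..n. \<Sum>j = 0..k. of_bool (i' = i) * x (col k i' j)) =
      (\<Sum>i' = 1..n. if i' = i then \<Sum>j = 0..k. x (col k i j) else 0)"
    by (intro sum.cong) auto
  then show ?thesis using assms by (simp add: targets_def)
qed

text \<open>A row of slot \<open>j > 0\<close> only meets columns of the same slot, one for each
  target in the window. The double sum thus collapses to the shape of
  \<open>packing_row\<close>.\<close>

lemma sum_window_row:
  assumes "j \<in> sensors G"
  shows "(\<Sum>i' = 1..n. \<Sum>j' = 0..k. window_coeff G \<sigma> i j i' j' * x (col k i' j')) =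
    (\<Sum>i' \<in> {i' \<in> targets G. \<sigma> i \<le> \<sigma> i' \<and> int (\<sigma> i') - int (\<sigma> i) \<le> window G}.
       (2 - int (sensing G i' j)) * x (col k i' j))"
proof -
  have "(\<Sum>i' = 1..n. \<Sum>j' = 0..k. window_coeff G \<sigma> i j i' j' * x (col k i' j')) =
      (\<Sum>i' = 1..n. \<Sum>j' = 0..k. if j' = j then window_coeff G \<sigma> i j i' j * x (col k i' j) else 0)"
    using assms by (intro sum.cong) (auto simp: window_coeff_def sensors_def)
  also have "\<dots> = (\<Sum>i' = 1..n. window_coeff G \<sigma> i j i' j * x (col k i' j))"
    using assms by (simp add: sensors_def)
  also have "\<dots> = (\<Sum>i' = 1..n. if \<sigma> i \<le> \<sigma> i' \<and> int (\<sigma> i') - int (\<sigma> i) \<le> window G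
      then (2 - int (sensing G i' j)) * x (col k i' j) else 0)"
    using assms by (intro sum.cong) (auto simp: window_coeff_def sensors_def)
  also have "\<dots> = (\<Sum>i' \<in> {i' \<in> targets G. \<sigma> i \<le> \<sigma> i' \<and> int (\<sigma> i') - int (\<sigma> i) \<le> window G}.
       (2 - int (sensing G i' j)) * x (col k i' j))"
    unfolding targets_def by (rule sum.inter_filter[symmetric]) simp
  finally show ?thesis .
qed

text \<open>The rows of slot 0 and the negated rows amount to one slot per target by
  \<open>partition_row\<close>; the window rows amount to capability and recharging by
  \<open>packing_row\<close>. If \<open>x\<close> is not a binary vector on the columns, both sides
  are false.\<close>

lemma feasible_iff:
  "feasible P x \<longleftrightarrow>
    x \<in> {1..n * Suc k} \<rightarrow>\<^sub>E {0, 1} \<and>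
    (\<forall>i\<in>targets G. \<exists>!j. j \<in> {0..k} \<and> x (col k i j) = 1) \<and>
    (\<forall>j\<in>sensors G. \<forall>i\<in>targets G. x (col k i j) = 1 \<longrightarrow> sensing G i j = 1) \<and>
    (\<forall>j\<in>sensors G. \<forall>i\<in>targets G. \<forall>i'\<in>targets G. i \<noteq> i' \<longrightarrow>
       x (col k i j) = 1 \<longrightarrow> x (col k i' j) = 1 \<longrightarrow> \<bar>int (\<sigma> i) - int (\<sigma> i')\<bar> > window G)"
  (is "_ \<longleftrightarrow> ?X \<and> ?R1 \<and> ?R2 \<and> ?R3")
proof (cases "?X")
  case X: True
  have x01: "x (col k i j) \<in> {0, 1}" if "i \<in> targets G" "j \<le> k" for i j
    using PiE_mem[OF X col_in[of i n j k]] that by (simp add: targets_def)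
  have D01: "sensing G i j = 0 \<or> sensing G i j = 1" if "i \<in> targets G" "j \<in> sensors G" for i j
    using esg that unfolding valid_esg_def by auto
  \<comment> \<open>Nonnegativity puts every target into its own window, so weight 2 reaches every
    incapable pair of target and sensor.\<close>
  have w0: "0 \<le> window G"
    unfolding window_def by (simp split: enat.split)
  let ?W = "\<lambda>i. {i' \<in> targets G. \<sigma> i \<le> \<sigma> i' \<and> int (\<sigma> i') - int (\<sigma> i) \<le> window G}"
  have lhs: "(\<Sum>c = 1..n * Suc k. coeff P (col k i j) c * x c) =
        (\<Sum>i' = 1..n. \<Sum>j' = 0..k. window_coeff G \<sigma> i j i' j' * x (col k i' j'))"
      "(\<Sum>c = 1..n * Suc k. coeff P (n * Suc k + col k i j) c * x c) = (\<Sum>j = 0..k. - x (col k i j))"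
      "rhs P (col k i j) = 1" "rhs P (n * Suc k + col k i j) = - 1"
    if ij: "i \<in> targets G" "j \<le> k" for i j
  proof -
    have i: "1 \<le> i" using ij by (simp add: targets_def)
    have r: "col k i j \<in> {1..n * Suc k}"
      using ij unfolding targets_def by (rule col_in)
    then show "rhs P (col k i j) = 1" "rhs P (n * Suc k + col k i j) = - 1"
      using ilp unfolding slot_ilp_def Let_def by blast+
    have "coeff P (col k i j) (col k i' j') = window_coeff G \<sigma> i j i' j' \<and>
        coeff P (n * Suc k + col k i j) (col k i' j') = - of_bool (i' = i)"
      if "i' \<in> {1..n}" "j' \<in> {0..k}" for i' j'
    proof -
      have c: "1 \<le> i'" "j' \<le> k" using that by auto
      have "col k i' j' \<in> {1..n * Suc k}" using that(1) c(2) by (rule col_in)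
      then show ?thesis
        using ilp r i ij c unfolding slot_ilp_def Let_def
        by (simp add: tgt_col slot_col del: mult_Suc_right)
    qed
    then show "(\<Sum>c = 1..n * Suc k. coeff P (col k i j) c * x c) =
        (\<Sum>i' = 1..n. \<Sum>j' = 0..k. window_coeff G \<sigma> i j i' j' * x (col k i' j'))"
      "(\<Sum>c = 1..n * Suc k. coeff P (n * Suc k + col k i j) c * x c) = (\<Sum>j = 0..k. - x (col k i j))"
      unfolding sum_cols using sum_slot0_row[OF ij(1), of "\<lambda>c. - x c"] by simp_all
  qed
  have "feasible P x \<longleftrightarrow> (\<forall>i\<in>targets G. \<forall>j\<in>{0..k}.
      (\<Sum>i' = 1..n. \<Sum>j' = 0..k. window_coeff G \<sigma> i j i' j' * x (col k i' j')) \<le> 1 \<and>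
      (\<Sum>j = 0..k. - x (col k i j)) \<le> - 1)"
    (is "_ \<longleftrightarrow> (\<forall>i\<in>targets G. \<forall>j\<in>{0..k}. ?S i j \<le> 1 \<and> ?T i)")
  proof -
    have "num_vars P = n * Suc k" using ilp unfolding slot_ilp_def Let_def by blast
    then have "feasible P x \<longleftrightarrow> (\<forall>r\<in>{1..num_constrs P}. (\<Sum>c = 1..n * Suc k. coeff P r c * x c) \<le> rhs P r)"
      using X unfolding feasible_def by simp
    also have "\<dots> \<longleftrightarrow> (\<forall>i\<in>targets G. \<forall>j\<in>{0..k}. ?S i j \<le> 1 \<and> ?T i)"
      unfolding ball_rows ball_cols using lhs by (intro ball_cong refl) (simp del: mult_Suc_right)
    finally show ?thesis .
  qed
  \<comment> \<open>\<open>?T i\<close> does not mention the slot of its row, so the k + 1 copies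
    amount to one, which is kept with slot 0.\<close>
  also have "\<dots> \<longleftrightarrow> (\<forall>i\<in>targets G. ?S i 0 \<le> 1 \<and> ?T i) \<and> (\<forall>j\<in>sensors G. \<forall>i\<in>targets G. ?S i j \<le> 1)"
  proof -
    have "{0..k} = insert 0 (sensors G)" by (auto simp: sensors_def)
    then show ?thesis by auto
  qed
  also have "(\<forall>i\<in>targets G. ?S i 0 \<le> 1 \<and> ?T i) \<longleftrightarrow> ?R1"
  proof (intro ball_cong refl)
    fix i assume i: "i \<in> targets G"
    have "?S i 0 = (\<Sum>j = 0..k. x (col k i j))"
      unfolding sum_slot0_row[OF i, symmetric] by (simp add: window_coeff_def)
    then show "(?S i 0 \<le> 1 \<and> ?T i) \<longleftrightarrow> (\<exists>!j. j \<in> {0..k} \<and> x (col k i j) = 1)"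
      using partition_row[of "{0..k}" "\<lambda>j. x (col k i j)"] x01[OF i] by simp
  qed
  also have "(\<forall>j\<in>sensors G. \<forall>i\<in>targets G. ?S i j \<le> 1) \<longleftrightarrow> ?R2 \<and> ?R3"
  proof -
    have row: "?S i j \<le> 1 \<longleftrightarrow> (\<forall>i'\<in>?W i. x (col k i' j) = 1 \<longrightarrow> sensing G i' j = 1) \<and>
       (\<forall>i'\<in>?W i. \<forall>i''\<in>?W i. x (col k i' j) = 1 \<longrightarrow> x (col k i'' j) = 1 \<longrightarrow> i' = i'')"
      if "i \<in> targets G" "j \<in> sensors G" for i j
    proof -
      have "j \<le> k" using that by (simp add: sensors_def)
      have "finite (?W i)" by (simp add: targets_def)
      moreover have "2 - int (sensing G i' j) \<in> {1, 2}" if "i' \<in> ?W i" for i'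
        using D01[of i' j] that \<open>j \<in> sensors G\<close> by auto
      moreover have "x (col k i' j) \<in> {0, 1}" if "i' \<in> ?W i" for i'
        using x01 that \<open>j \<le> k\<close> by auto
      ultimately have "(\<Sum>i'\<in>?W i. (2 - int (sensing G i' j)) * x (col k i' j)) \<le> 1 \<longleftrightarrow>
        (\<forall>i'\<in>?W i. x (col k i' j) = 1 \<longrightarrow> 2 - int (sensing G i' j) = 1) \<and>
        (\<forall>i'\<in>?W i. \<forall>i''\<in>?W i. x (col k i' j) = 1 \<longrightarrow> x (col k i'' j) = 1 \<longrightarrow> i' = i'')"
        by (rule packing_row)
      moreover have "2 - int d = 1 \<longleftrightarrow> d = 1" for d by auto
      ultimately show ?thesis unfolding sum_window_row[OF that(2)] by simp
    qed
    show ?thesis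
    proof
      assume L: "\<forall>j\<in>sensors G. \<forall>i\<in>targets G. ?S i j \<le> 1"
      have self: "i \<in> ?W i" if "i \<in> targets G" for i using w0 that by simp
      have ?R2
        using L row self by blast
      \<comment> \<open>If \<open>i\<close> is the earlier of two close targets, its own window row
        contains both, and that row admits only one selected target.\<close>
      have same: "i = i'" if j: "j \<in> sensors G" and i: "i \<in> targets G" "i' \<in> targets G"
        "x (col k i j) = 1" "x (col k i' j) = 1" "\<sigma> i \<le> \<sigma> i'" "int (\<sigma> i') - int (\<sigma> i) \<le> window G" for i i' j
        using L[rule_format, OF j i(1)] row[OF i(1) j] self[OF i(1)] i by blast
      have ?R3
      proof (intro ballI impI, rule ccontr)
        fix j i i' assume *: "j \<in> sensors G" "i \<in> targets G" "i' \<in> targets G" "i \<noteq> i'"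
          "x (col k i j) = 1" "x (col k i' j) = 1" "\<not> window G < \<bar>int (\<sigma> i) - int (\<sigma> i')\<bar>"
        show False
        proof (cases "\<sigma> i \<le> \<sigma> i'")
          case True
          then have "int (\<sigma> i') - int (\<sigma> i) \<le> window G" using *(7) by linarith
          then show False using same[of j i i'] * True by blast
        next
          case False
          then have "\<sigma> i' \<le> \<sigma> i" "int (\<sigma> i) - int (\<sigma> i') \<le> window G" using *(7) by linarith+
          then show False using same[of j i' i] * by blast
        qed
      qed
      with \<open>?R2\<close> show "?R2 \<and> ?R3" ..
    next
      assume R: "?R2 \<and> ?R3"
      show "\<forall>j\<in>sensors G. \<forall>i\<in>targets G. ?S i j \<le> 1"
      proof (intro ballI)
        fix j i assume ji: "j \<in> sensors G" "i \<in> targets G"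
        \<comment> \<open>All positions in \<open>?W i\<close> lie in an interval of length
          \<open>window G\<close>, so two distinct selected targets there would violate
          \<open>?R3\<close>.\<close>
        have "i' = i''" if "i' \<in> ?W i" "i'' \<in> ?W i" "x (col k i' j) = 1" "x (col k i'' j) = 1" for i' i''
        proof (rule ccontr)
          assume "i' \<noteq> i''"
          then have "\<bar>int (\<sigma> i') - int (\<sigma> i'')\<bar> > window G" using R ji that by blast
          then show False using that by auto
        qed
        then show "?S i j \<le> 1"
          unfolding row[OF ji(2,1)] using R ji by blast
      qed
    qed
  qed
  finally show ?thesis using X by blast
next
  case False
  then show ?thesis
    using ilp unfolding feasible_def slot_ilp_def Let_def by simp
qed

text \<open>Each target occupies exactly one slot, so slot 0 is taken precisely when no sensor's
  slot is. The slot 0 variables are therefore the indicators of the terms summed in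
  \<open>plan_value\<close>.\<close>

lemma unsensed_iff:
  assumes "feasible P x" "i \<in> targets G"
  shows "x (col k i 0) = 1 \<longleftrightarrow> i \<notin> (\<Union>j\<in>sensors G. plan_of G x j)"
proof -
  have "{0..k} = insert 0 (sensors G)" "0 \<notin> sensors G" by (auto simp: sensors_def)
  moreover have "\<exists>!j. j \<in> {0..k} \<and> x (col k i j) = 1"
    using assms feasible_iff by blast
  ultimately show ?thesis
    using assms(2) by (auto simp: plan_of_def)
qed

text \<open>Disjointness of the sensed sets is uniqueness of the slot; the other requirements are
  the capability and window conditions of \<open>feasible_iff\<close>, with the distance translated
  back by \<open>recharged_iff\<close>.\<close>

lemma valid_plan_plan_of:
  assumes "feasible P x"
  shows "valid_plan G \<sigma> (plan_of G x)"
proof -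
  note x = assms[unfolded feasible_iff]
  have "j = j'" if "i \<in> plan_of G x j" "i \<in> plan_of G x j'" "j \<in> sensors G" "j' \<in> sensors G" for i j j'
  proof -
    have "i \<in> targets G" "x (col k i j) = 1" "x (col k i j') = 1" "j \<in> {0..k}" "j' \<in> {0..k}"
      using that by (auto simp: plan_of_def sensors_def)
    then show ?thesis using x by blast
  qed
  then have "sensing_plan G (plan_of G x)"
    unfolding sensing_plan_def by (auto simp: plan_of_def)
  moreover have "recharge G < enat (nat \<bar>int (\<sigma> t) - int (\<sigma> t')\<bar>)"
    if "s \<in> sensors G" "t \<in> plan_of G x s" "t' \<in> plan_of G x s" "t \<noteq> t'" for s t t'
  proof -
    have t: "t \<in> targets G" "t' \<in> targets G" "x (col k t s) = 1" "x (col k t' s) = 1"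
      using that by (auto simp: plan_of_def)
    then have "\<bar>int (\<sigma> t) - int (\<sigma> t')\<bar> > window G"
      using x that by blast
    then show ?thesis using recharged_iff[OF ordering] t by blast
  qed
  ultimately show ?thesis
    unfolding valid_plan_def using x by (auto simp: plan_of_def)
qed

lemma objective_eq:
  assumes "feasible P x"
  shows "objective P x = plan_value G (plan_of G x)"
proof -
  have x01: "x (col k i 0) \<in> {0, 1}" if "i \<in> targets G" for i
    using PiE_mem[OF conjunct1[OF assms[unfolded feasible_iff]] col_in[of i n 0 k]] that
    by (simp add: targets_def)
  have "objective P x = (\<Sum>c = 1..n * Suc k. obj P c * of_int (x c))"
    using ilp unfolding objective_def slot_ilp_def Let_def by simp
  also have "\<dots> = (\<Sum>i = 1..n. \<Sum>j = 0..k. obj P (col k i j) * of_int (x (col k i j)))"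
    by (rule sum_cols)
  also have "\<dots> = (\<Sum>i = 1..n. \<Sum>j = 0..k. if j = 0 then target_value G i * of_int (x (col k i 0)) else 0)"
  proof (intro sum.cong refl)
    fix i j assume ij: "i \<in> {1..n}" "j \<in> {0..k}"
    then have "col k i j \<in> {1..n * Suc k}" by (intro col_in) simp_all
    then show "obj P (col k i j) * of_int (x (col k i j)) =
        (if j = 0 then target_value G i * of_int (x (col k i 0)) else 0)"
      using ilp ij unfolding slot_ilp_def Let_def by (simp add: tgt_col slot_col)
  qed
  also have "\<dots> = (\<Sum>i\<in>targets G. target_value G i * of_int (x (col k i 0)))"
    by (simp add: targets_def)
  also have "\<dots> = (\<Sum>i\<in>targets G. if i \<notin> (\<Union>j\<in>sensors G. plan_of G x j) then target_value G i else 0)"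
    using unsensed_iff[OF assms] x01 by (intro sum.cong) auto
  also have "\<dots> = plan_value G (plan_of G x)"
    unfolding plan_value_def set_diff_eq by (rule sum.inter_filter[symmetric]) (simp add: targets_def)
  finally show ?thesis .
qed

text \<open>The preimage is the incidence vector of the plan, where slot 0 collects the targets that
  no sensor senses. Disjointness of the sensed sets makes the slot unique.\<close>

lemma ex_feasible:
  assumes "valid_plan G \<sigma> \<psi>"
  shows "\<exists>x. feasible P x \<and> plan_of G x = \<psi>"
proof -
  define sel where "sel i j \<longleftrightarrow> (if j = 0 then i \<notin> (\<Union>s\<in>sensors G. \<psi> s) else i \<in> \<psi> j)" for i j
  define x :: "nat \<Rightarrow> int" where
    "x = (\<lambda>c\<in>{1..n * Suc k}. of_bool (sel (tgt k c) (slot k c)))"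
  have x: "x (col k i j) = of_bool (sel i j)" if "i \<in> targets G" "j \<le> k" for i j
  proof -
    have "1 \<le> i" using that by (simp add: targets_def)
    moreover have "col k i j \<in> {1..n * Suc k}"
      using that unfolding targets_def by (rule col_in)
    ultimately show ?thesis using that unfolding x_def by (simp add: tgt_col slot_col del: mult_Suc_right)
  qed
  have sens: "j \<le> k \<and> j \<noteq> 0" if "j \<in> sensors G" for j using that by (simp add: sensors_def)
  have xs: "x (col k i j) = 1 \<longleftrightarrow> i \<in> \<psi> j" if "i \<in> targets G" "j \<in> sensors G" for i j
    using x[of i j] sens[of j] that by (simp add: sel_def)
  note \<psi> = assms[unfolded valid_plan_def sensing_plan_def]
  have uniq: "\<exists>!j. j \<in> {0..k} \<and> x (col k i j) = 1" if i: "i \<in> targets G" for i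
  proof -
    have "\<exists>!j. j \<in> {0..k} \<and> sel i j"
    proof (cases "\<exists>s\<in>sensors G. i \<in> \<psi> s")
      case True
      then obtain s where s: "s \<in> sensors G" "i \<in> \<psi> s" by blast
      have "j = s" if "j \<in> {0..k}" "sel i j" for j
      proof (cases "j = 0")
        case True
        then show ?thesis using that s by (auto simp: sel_def)
      next
        case False
        then have "j \<in> sensors G" "i \<in> \<psi> j" using that by (auto simp: sel_def sensors_def)
        then show ?thesis using \<psi> s by blast
      qed
      moreover have "s \<in> {0..k} \<and> sel i s" using s sens by (auto simp: sel_def)
      ultimately show ?thesis by blast
    next
      case False
      have "j = 0" if "j \<in> {0..k}" "sel i j" for j
        using False that by (cases "j = 0") (auto simp: sel_def sensors_def)
      moreover have "sel i 0" using False by (simp add: sel_def)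
      ultimately show ?thesis by (metis atLeastAtMost_iff le0)
    qed
    then show ?thesis using x[OF i] by auto
  qed
  have "feasible P x"
    unfolding feasible_iff
  proof (intro conjI ballI impI)
    show "x \<in> {1..n * Suc k} \<rightarrow>\<^sub>E {0, 1}" unfolding x_def by auto
    show "\<exists>!j. j \<in> {0..k} \<and> x (col k i j) = 1" if "i \<in> targets G" for i using uniq that .
    show "sensing G i j = 1" if "j \<in> sensors G" "i \<in> targets G" "x (col k i j) = 1" for i j
      using \<psi> xs that by blast
    show "\<bar>int (\<sigma> i) - int (\<sigma> i')\<bar> > window G"
      if "j \<in> sensors G" "i \<in> targets G" "i' \<in> targets G" "i \<noteq> i'" "x (col k i j) = 1" "x (col k i' j) = 1"
      for i i' j
    proof -
      have "recharge G < enat (nat \<bar>int (\<sigma> i) - int (\<sigma> i')\<bar>)" using \<psi> xs that by blast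
      then show ?thesis using recharged_iff[OF ordering] that by blast
    qed
  qed
  moreover have "plan_of G x = \<psi>"
  proof (rule extensionalityI[where A = "sensors G"])
    show "plan_of G x \<in> extensional (sensors G)" by (simp add: plan_of_def)
    show "\<psi> \<in> extensional (sensors G)" using \<psi> by (auto simp: PiE_def)
    show "plan_of G x j = \<psi> j" if "j \<in> sensors G" for j
      using xs that \<psi> by (fastforce simp: plan_of_def)
  qed
  ultimately show ?thesis by blast
qed

lemma encodes: "encodes_best_red_response P (plan_of G) G \<sigma>"
proof -
  have img: "plan_of G ` {x. feasible P x} = {\<psi>. valid_plan G \<sigma> \<psi>}"
    using valid_plan_plan_of ex_feasible by blast
  \<comment> \<open>Decoding maps the feasible solutions onto the valid plans and keeps the value,
    so a strictly better solution exists exactly when a strictly better plan does.\<close>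
  have opt: "optimal P x \<longleftrightarrow> feasible P x \<and> best_red_response G \<sigma> (plan_of G x)" for x
    unfolding optimal_def best_red_response_def is_arg_min_def
    using objective_eq valid_plan_plan_of ex_feasible by metis
  have "plan_of G ` {x. optimal P x} = {\<psi>. best_red_response G \<sigma> \<psi>}"
  proof (intro equalityI subsetI)
    fix \<psi> assume "\<psi> \<in> {\<psi>. best_red_response G \<sigma> \<psi>}"
    moreover from this have "valid_plan G \<sigma> \<psi>"
      unfolding best_red_response_def is_arg_min_def by blast
    then obtain x where "feasible P x" "plan_of G x = \<psi>"
      using ex_feasible by blast
    ultimately show "\<psi> \<in> plan_of G ` {x. optimal P x}"
      using opt by blast
  qed (use opt in auto)
  then show ?thesis
    unfolding encodes_best_red_response_def using img objective_eq by blast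
qed

end

section \<open>Construction and decoding in polynomial time\<close>

text \<open>Multiplication by repeated addition gives \<open>N\<close>; the second loop runs the
  odometer of \<open>tgt_Suc\<close> and \<open>slot_Suc\<close>. Setting \<open>J\<close> at 0 to k
  installs the virtual column 0, whose target 0 comes from the zeroed memory.\<close>

definition index_cols :: com where
  "index_cols =
    Then (WhileLess (scalar ''h'') (scalar ''n'')
      (Then (incr ''h'') (Set_scalar ''N'' (Add (scalar ''N'') (Add (scalar ''k'') (Const 1))))))
    (Then (Then (Set_vec ''J'' (Const 0) (scalar ''k'')) (Set_scalar ''h'' (Const 0)))
    (WhileLess (scalar ''h'') (scalar ''N'')
      (Then (incr ''h'')
        (IfLess (vec ''J'' (Sub (scalar ''h'') (Const 1))) (scalar ''k'')
          (Then (Set_vec ''J'' (scalar ''h'') (Add (vec ''J'' (Sub (scalar ''h'') (Const 1))) (Const 1)))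
            (Set_vec ''I'' (scalar ''h'') (vec ''I'' (Sub (scalar ''h'') (Const 1)))))
          (Then (Set_vec ''J'' (scalar ''h'') (Const 0))
            (Set_vec ''I'' (scalar ''h'') (Add (vec ''I'' (Sub (scalar ''h'') (Const 1))) (Const 1))))))))"

definition indexed :: "nat \<Rightarrow> nat \<Rightarrow> store \<Rightarrow> bool" where
  "indexed n k s \<longleftrightarrow> ints s ''N'' 0 0 = int (n * Suc k) \<and>
    (\<forall>c\<le>n * Suc k. ints s ''I'' (int c) 0 = int (tgt k c) \<and> ints s ''J'' (int c) 0 = int (slot k c))"

lemma runs_index_cols:
  assumes "ints s ''n'' 0 0 = int n" "ints s ''k'' 0 0 = int k"
    "ints s ''h'' 0 0 = 0" "ints s ''N'' 0 0 = 0" "ints s ''I'' 0 0 = 0"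
  shows "runs index_cols s (n * 3 + 1 + (2 + (n * Suc k * 7 + 1)))
    (\<lambda>s'. indexed n k s' \<and> agree_off {''h'', ''N'', ''I'', ''J''} (ints s) (ints s') \<and> reals s' = reals s)"
proof -
  let ?X = "{''h'', ''N'', ''I'', ''J''}"
  \<comment> \<open>The frame \<open>?X\<close> exempts \<open>I\<close>, so the zero at its origin
    has to be carried explicitly to the second loop.\<close>
  define Inv1 where "Inv1 i s' \<longleftrightarrow> ints s' ''h'' 0 0 = int i \<and> ints s' ''N'' 0 0 = int (i * Suc k) \<and>
      ints s' ''I'' 0 0 = 0 \<and> agree_off ?X (ints s) (ints s') \<and> reals s' = reals s" for i and s' :: store
  define Inv2 where "Inv2 i s' \<longleftrightarrow> ints s' ''h'' 0 0 = int i \<and> ints s' ''N'' 0 0 = int (n * Suc k) \<and>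
      (\<forall>c\<le>i. ints s' ''I'' (int c) 0 = int (tgt k c) \<and> ints s' ''J'' (int c) 0 = int (slot k c)) \<and>
      agree_off ?X (ints s) (ints s') \<and> reals s' = reals s" for i and s' :: store
  have nk: "ints s' ''n'' 0 0 = int n" "ints s' ''k'' 0 0 = int k" if "agree_off ?X (ints s) (ints s')" for s' :: store
    using assms agree_offD[OF that] by simp_all
  show ?thesis
    unfolding index_cols_def
  proof (intro runs_Then)
    have "runs (WhileLess (scalar ''h'') (scalar ''n'')
        (Then (incr ''h'') (Set_scalar ''N'' (Add (scalar ''N'') (Add (scalar ''k'') (Const 1))))))
        s (n * Suc 2 + 1) (Inv1 n)"
    proof (rule runs_WhileLess)
      show "Inv1 0 s" using assms by (simp add: Inv1_def)
    next
      fix i s' assume "Inv1 i s'"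
      then show "runs (Then (incr ''h'') (Set_scalar ''N'' (Add (scalar ''N'') (Add (scalar ''k'') (Const 1)))))
          s' 2 (Inv1 (Suc i))"
        by (intro runs_loop_free) (simp_all add: Inv1_def nk upd_apply algebra_simps)
    next
      fix i s' assume "Inv1 i s'"
      then show "aval (scalar ''h'') s' < aval (scalar ''n'') s' \<longleftrightarrow> i < n"
        by (simp add: Inv1_def nk)
    qed
    then show "runs (WhileLess (scalar ''h'') (scalar ''n'')
        (Then (incr ''h'') (Set_scalar ''N'' (Add (scalar ''N'') (Add (scalar ''k'') (Const 1))))))
        s (n * 3 + 1) (Inv1 n)"
      by simp
  next
    fix s' assume "Inv1 n s'"
    then show "runs (Then (Set_vec ''J'' (Const 0) (scalar ''k'')) (Set_scalar ''h'' (Const 0))) s' 2 (Inv2 0)"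
      by (intro runs_loop_free) (simp_all add: Inv1_def Inv2_def nk upd_apply)
  next
    fix s' assume "Inv2 0 s'"
    then have "runs (WhileLess (scalar ''h'') (scalar ''N'')
      (Then (incr ''h'')
        (IfLess (vec ''J'' (Sub (scalar ''h'') (Const 1))) (scalar ''k'')
          (Then (Set_vec ''J'' (scalar ''h'') (Add (vec ''J'' (Sub (scalar ''h'') (Const 1))) (Const 1)))
            (Set_vec ''I'' (scalar ''h'') (vec ''I'' (Sub (scalar ''h'') (Const 1)))))
          (Then (Set_vec ''J'' (scalar ''h'') (Const 0))
            (Set_vec ''I'' (scalar ''h'') (Add (vec ''I'' (Sub (scalar ''h'') (Const 1))) (Const 1))))))) s' (n * Suc k * Suc 6 + 1) (Inv2 (n * Suc k))"
      (is "runs (WhileLess _ _ ?c) _ _ _")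
    proof (rule runs_WhileLess)
      fix i s' assume "Inv2 i s'"
      then show "runs ?c s' 6 (Inv2 (Suc i))"
        by (intro runs_loop_free)
          (simp_all add: Inv2_def nk upd_apply tgt_Suc slot_Suc le_Suc_eq del: mult_Suc_right)
    next
      fix i s' assume "Inv2 i s'"
      then have "ints s' ''h'' 0 0 = int i" "ints s' ''N'' 0 0 = int (n * Suc k)"
        unfolding Inv2_def by blast+
      then show "aval (scalar ''h'') s' < aval (scalar ''N'') s' \<longleftrightarrow> i < n * Suc k"
        by (simp only: aval.simps of_nat_less_iff)
    qed
    then show "runs (WhileLess (scalar ''h'') (scalar ''N'') ?c) s' (n * Suc k * 7 + 1)
      (\<lambda>s'. indexed n k s' \<and> agree_off ?X (ints s) (ints s') \<and> reals s' = reals s)"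
      by (rule runs_mono) (simp_all add: Inv2_def indexed_def)
  qed
qed

section \<open>Filling the matrix, the right-hand side and the objective\<close>

definition fill_slot :: com where
  "fill_slot =
    IfLess (vec ''I'' (scalar ''q'')) (vec ''I'' (scalar ''r''))
      (Assign ''A'' (Add (scalar ''N'') (scalar ''r'')) (scalar ''q'') (Const 0))
    (IfLess (vec ''I'' (scalar ''r'')) (vec ''I'' (scalar ''q''))
      (Assign ''A'' (Add (scalar ''N'') (scalar ''r'')) (scalar ''q'') (Const 0))
      (Assign ''A'' (Add (scalar ''N'') (scalar ''r'')) (scalar ''q'') (Const (- 1))))"

text \<open>Comparison is only by \<open><\<close>, so equality of slots is the failure of both
  strict tests. In a slot 0 row the entry is the negative of the one in row \<open>N + r\<close>,
  which \<open>fill_slot\<close> has just written.\<close>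

definition fill_window :: com where
  "fill_window = (let zero = Assign ''A'' (scalar ''r'') (scalar ''q'') (Const 0) in
    IfLess (Const 0) (vec ''J'' (scalar ''r''))
      (IfLess (vec ''J'' (scalar ''q'')) (vec ''J'' (scalar ''r'')) zero
      (IfLess (vec ''J'' (scalar ''r'')) (vec ''J'' (scalar ''q'')) zero
      (IfLess (vec ''sigma'' (vec ''I'' (scalar ''q''))) (vec ''sigma'' (vec ''I'' (scalar ''r''))) zero
      (IfLess (scalar ''T'')
        (Sub (vec ''sigma'' (vec ''I'' (scalar ''q''))) (vec ''sigma'' (vec ''I'' (scalar ''r'')))) zero
      (Assign ''A'' (scalar ''r'') (scalar ''q'')
        (Sub (Const 2) (Entry ''D'' (vec ''I'' (scalar ''q'')) (vec ''J'' (scalar ''q'')))))))))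
      (Assign ''A'' (scalar ''r'') (scalar ''q'')
        (Sub (Const 0) (Entry ''A'' (Add (scalar ''N'') (scalar ''r'')) (scalar ''q'')))))"

definition fill_entry :: com where
  "fill_entry = Then fill_slot fill_window"

text \<open>The input \<open>v\<close> is zero off its column 0, so copying the entry at (target,
  slot) yields the target value for slot 0 and zero for all other slots without a branch. The row
  index doubles as a column index for \<open>c\<close>, as both range over 1..N here.\<close>

definition fill_row :: com where
  "fill_row =
    Then
      (Then (Set_vec ''b'' (scalar ''r'') (Const 1))
      (Then (Set_vec ''b'' (Add (scalar ''N'') (scalar ''r'')) (Const (- 1)))
      (Then (Copy ''c'' (scalar ''r'') (Const 0) ''v'' (vec ''I'' (scalar ''r'')) (vec ''J'' (scalar ''r'')))
        (Set_scalar ''q'' (Const 0)))))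
      (WhileLess (scalar ''q'') (scalar ''N'') (Then (incr ''q'') fill_entry))"

text \<open>A negative \<open>tau\<close> stands for infinity and is replaced by n, in accordance
  with \<open>window\<close>. The counter \<open>r\<close> starts from the zeroed memory.\<close>

definition build_ilp :: com where
  "build_ilp =
    Then index_cols
    (Then (Then (Set_scalar ''T'' (scalar ''tau''))
      (Then (Set_scalar ''M'' (Add (scalar ''N'') (scalar ''N'')))
        (IfLess (scalar ''tau'') (Const 0) (Set_scalar ''T'' (scalar ''n'')) Skip)))
    (WhileLess (scalar ''r'') (scalar ''N'') (Then (incr ''r'') fill_row)))"

definition slot_coeff :: "store \<Rightarrow> int \<Rightarrow> int \<Rightarrow> int" where
  "slot_coeff s r c = of_bool (ints s ''I'' c 0 = ints s ''I'' r 0)"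

text \<open>The counterpart of \<open>window_coeff\<close> in terms of the arrays alone. The loop
  proofs thereby speak only of memory; tables are related to targets and slots once, when an
  instance is given.\<close>

definition row_coeff :: "store \<Rightarrow> int \<Rightarrow> int \<Rightarrow> int" where
  "row_coeff s r c =
    (if ints s ''J'' r 0 \<le> 0 then slot_coeff s r c
     else if ints s ''J'' c 0 = ints s ''J'' r 0 \<and>
       ints s ''sigma'' (ints s ''I'' r 0) 0 \<le> ints s ''sigma'' (ints s ''I'' c 0) 0 \<and>
       ints s ''sigma'' (ints s ''I'' c 0) 0 - ints s ''sigma'' (ints s ''I'' r 0) 0 \<le> ints s ''T'' 0 0
     then 2 - ints s ''D'' (ints s ''I'' c 0) (ints s ''J'' c 0) else 0)"

text \<open>The coefficients depend on five arrays that the filling loops never write, so values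
  computed in any intermediate store are those of the initial one.\<close>

lemma row_coeff_cong:
  assumes "agree_off X (ints s) (ints s')" "X \<inter> {''I'', ''J'', ''sigma'', ''T'', ''D''} = {}"
  shows "row_coeff s' = row_coeff s" "slot_coeff s' = slot_coeff s"
proof -
  have "ints s' a = ints s a" if "a \<in> {''I'', ''J'', ''sigma'', ''T'', ''D''}" for a
    using assms that unfolding agree_off_def by blast
  then show "row_coeff s' = row_coeff s" "slot_coeff s' = slot_coeff s"
    by (simp_all add: row_coeff_def slot_coeff_def fun_eq_iff)
qed

lemma result_fill_entry:
  "reals (result fill_entry s) = reals s"
    "ints (result fill_entry s) a i j =
      (if a = ''A'' \<and> j = ints s ''q'' 0 0 \<and> i = ints s ''r'' 0 0
       then row_coeff s (ints s ''r'' 0 0) (ints s ''q'' 0 0)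
       else if a = ''A'' \<and> j = ints s ''q'' 0 0 \<and> i = ints s ''N'' 0 0 + ints s ''r'' 0 0
       then - slot_coeff s (ints s ''r'' 0 0) (ints s ''q'' 0 0) else ints s a i j)"
proof -
  let ?r = "ints s ''r'' 0 0" and ?q = "ints s ''q'' 0 0" and ?N = "ints s ''N'' 0 0"
  have 1: "result fill_slot s = s\<lparr>ints := upd (ints s) ''A'' (?N + ?r) ?q (- slot_coeff s ?r ?q)\<rparr>"
    by (simp add: fill_slot_def slot_coeff_def)
  have 2: "result fill_window (s\<lparr>ints := upd (ints s) ''A'' (?N + ?r) ?q (- slot_coeff s ?r ?q)\<rparr>) =
      s\<lparr>ints := upd (upd (ints s) ''A'' (?N + ?r) ?q (- slot_coeff s ?r ?q)) ''A'' ?r ?q (row_coeff s ?r ?q)\<rparr>"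
    by (simp add: fill_window_def Let_def row_coeff_def upd_apply)
  show "reals (result fill_entry s) = reals s"
    by (simp add: fill_entry_def 1 2)
  show "ints (result fill_entry s) a i j =
      (if a = ''A'' \<and> j = ?q \<and> i = ?r then row_coeff s ?r ?q
       else if a = ''A'' \<and> j = ?q \<and> i = ?N + ?r then - slot_coeff s ?r ?q else ints s a i j)"
    by (simp add: fill_entry_def 1 2 upd_apply)
qed

lemma runs_fill_entries:
  assumes "ints s ''N'' 0 0 = int N" "ints s ''r'' 0 0 = int r" "ints s ''q'' 0 0 = 0"
  shows "runs (WhileLess (scalar ''q'') (scalar ''N'') (Then (incr ''q'') fill_entry)) s (N * 20 + 1)
    (\<lambda>s'. agree_off {''A'', ''q''} (ints s) (ints s') \<and> reals s' = reals s \<and>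
      (\<forall>c\<in>{1..N}. ints s' ''A'' (int r) (int c) = row_coeff s (int r) (int c) \<and>
         ints s' ''A'' (int (N + r)) (int c) = - slot_coeff s (int r) (int c)) \<and>
      (\<forall>i j. i \<noteq> int r \<longrightarrow> i \<noteq> int (N + r) \<longrightarrow> ints s' ''A'' i j = ints s ''A'' i j))"
proof -
  define Inv where "Inv m s' \<longleftrightarrow> ints s' ''q'' 0 0 = int m \<and>
      agree_off {''A'', ''q''} (ints s) (ints s') \<and> reals s' = reals s \<and>
      (\<forall>c\<in>{1..m}. ints s' ''A'' (int r) (int c) = row_coeff s (int r) (int c) \<and>
         ints s' ''A'' (int (N + r)) (int c) = - slot_coeff s (int r) (int c)) \<and>
      (\<forall>i j. i \<noteq> int r \<longrightarrow> i \<noteq> int (N + r) \<longrightarrow> ints s' ''A'' i j = ints s ''A'' i j)" for m and s' :: store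
  have "runs (WhileLess (scalar ''q'') (scalar ''N'') (Then (incr ''q'') fill_entry)) s
      (N * Suc 19 + 1) (Inv N)"
  proof (rule runs_WhileLess)
    show "Inv 0 s" using assms by (simp add: Inv_def agree_off_def)
  next
    fix m s' assume m: "m < N" and I: "Inv m s'"
    let ?s = "result (incr ''q'') s'"
    have 1: "agree_off {''A'', ''q''} (ints s) (ints ?s)" "ints ?s ''q'' 0 0 = int (Suc m)"
        "reals ?s = reals s" "ints ?s ''A'' = ints s' ''A''"
      using I by (auto simp: Inv_def agree_off_def upd_apply upd_other)
    have 2: "ints ?s ''N'' 0 0 = int N" "ints ?s ''r'' 0 0 = int r"
      using 1(1) assms by (simp_all add: agree_off_def)
    have coeffs: "row_coeff ?s = row_coeff s" "slot_coeff ?s = slot_coeff s"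
      using 1(1) by (rule row_coeff_cong, simp)+
    have "Inv (Suc m) (result fill_entry ?s)"
      unfolding Inv_def agree_off_def
    proof (intro conjI ballI allI impI)
      show "ints (result fill_entry ?s) ''q'' 0 0 = int (Suc m)"
        by (simp add: result_fill_entry 1 del: result.simps)
      show "reals (result fill_entry ?s) = reals s"
        by (simp add: result_fill_entry 1 del: result.simps)
    next
      fix a assume "a \<notin> {''A'', ''q''}"
      then show "ints (result fill_entry ?s) a = ints s a"
        using 1(1) by (simp add: fun_eq_iff result_fill_entry agree_off_def del: result.simps)
    next
      fix c assume "c \<in> {1..Suc m}"
      then consider "c = Suc m" | "c \<in> {1..m}" by fastforce
      then show "ints (result fill_entry ?s) ''A'' (int r) (int c) = row_coeff s (int r) (int c)"
          "ints (result fill_entry ?s) ''A'' (int (N + r)) (int c) = - slot_coeff s (int r) (int c)"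
        \<comment> \<open>For an earlier column the new write is in a different column. For column
          \<open>Suc m\<close>, \<open>m < N\<close> gives \<open>N > 0\<close>, so the write to row
          \<open>r\<close> leaves row \<open>N + r\<close> intact.\<close>
        using I m by (cases; simp add: Inv_def result_fill_entry 1 2 coeffs del: result.simps)+
    next
      fix i j assume "i \<noteq> int r" "i \<noteq> int (N + r)"
      then show "ints (result fill_entry ?s) ''A'' i j = ints s ''A'' i j"
        using I by (simp add: Inv_def result_fill_entry 1 2 del: result.simps)
    qed
    \<comment> \<open>The value of \<open>cost\<close> here is 17: 1 for the increment, 5 for
      \<open>fill_slot\<close> and 11 for \<open>fill_window\<close>.\<close>
    then show "runs (Then (incr ''q'') fill_entry) s' 19 (Inv (Suc m))"
      by (intro runs_loop_free) (simp_all add: fill_entry_def fill_slot_def fill_window_def Let_def)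
  next
    fix m s' assume "Inv m s'"
    then show "aval (scalar ''q'') s' < aval (scalar ''N'') s' \<longleftrightarrow> m < N"
      using assms by (simp add: Inv_def agree_off_def)
  qed
  then show ?thesis by (rule runs_mono) (simp_all add: Inv_def)
qed

text \<open>With \<open>N > 0\<close> the rows \<open>r\<close> and \<open>N + r\<close> differ, so
  the second write to \<open>b\<close> spares the first. The last conjunct is a frame by rows, which
  protects the finished rows in the outer loop.\<close>

lemma runs_fill_row:
  assumes "ints s ''N'' 0 0 = int N" "ints s ''r'' 0 0 = int r" "N > 0"
  shows "runs fill_row s (4 + (N * 20 + 1))
    (\<lambda>s'. agree_off {''A'', ''b'', ''q''} (ints s) (ints s') \<and> reals s' ''v'' = reals s ''v'' \<and>
      reals s' ''c'' (int r) 0 = reals s ''v'' (ints s ''I'' (int r) 0) (ints s ''J'' (int r) 0) \<and>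
      ints s' ''b'' (int r) 0 = 1 \<and> ints s' ''b'' (int (N + r)) 0 = - 1 \<and>
      (\<forall>c\<in>{1..N}. ints s' ''A'' (int r) (int c) = row_coeff s (int r) (int c) \<and>
         ints s' ''A'' (int (N + r)) (int c) = - slot_coeff s (int r) (int c)) \<and>
      (\<forall>i. i \<noteq> int r \<longrightarrow> i \<noteq> int (N + r) \<longrightarrow>
        ints s' ''A'' i = ints s ''A'' i \<and> ints s' ''b'' i = ints s ''b'' i \<and>
        reals s' ''c'' i = reals s ''c'' i))"
proof -
  define Mid where "Mid s' \<longleftrightarrow> agree_off {''b'', ''q''} (ints s) (ints s') \<and> ints s' ''q'' 0 0 = 0 \<and>
      reals s' = upd (reals s) ''c'' (int r) 0
        (reals s ''v'' (ints s ''I'' (int r) 0) (ints s ''J'' (int r) 0)) \<and>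
      ints s' ''b'' (int r) 0 = 1 \<and> ints s' ''b'' (int (N + r)) 0 = - 1 \<and>
      (\<forall>i. i \<noteq> int r \<longrightarrow> i \<noteq> int (N + r) \<longrightarrow> ints s' ''b'' i = ints s ''b'' i)" for s' :: store
  show ?thesis
    unfolding fill_row_def
  proof (rule runs_Then)
    show "runs (Then (Set_vec ''b'' (scalar ''r'') (Const 1))
      (Then (Set_vec ''b'' (Add (scalar ''N'') (scalar ''r'')) (Const (- 1)))
      (Then (Copy ''c'' (scalar ''r'') (Const 0) ''v'' (vec ''I'' (scalar ''r'')) (vec ''J'' (scalar ''r'')))
        (Set_scalar ''q'' (Const 0))))) s 4 Mid"
      using assms
      by (intro runs_loop_free) (auto simp: Mid_def upd_apply agree_off_def fun_eq_iff)
  next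
    fix s' assume M: "Mid s'"
    then have "row_coeff s' = row_coeff s" "slot_coeff s' = slot_coeff s"
      unfolding Mid_def by (auto intro: row_coeff_cong)
    moreover have "ints s' ''N'' 0 0 = int N" "ints s' ''r'' 0 0 = int r" "ints s' ''q'' 0 0 = 0"
      using M assms by (auto simp: Mid_def agree_off_def)
    note runs_fill_entries[OF this]
    ultimately show "runs (WhileLess (scalar ''q'') (scalar ''N'') (Then (incr ''q'') fill_entry)) s'
      (N * 20 + 1) (\<lambda>s'. agree_off {''A'', ''b'', ''q''} (ints s) (ints s') \<and> reals s' ''v'' = reals s ''v'' \<and>
      reals s' ''c'' (int r) 0 = reals s ''v'' (ints s ''I'' (int r) 0) (ints s ''J'' (int r) 0) \<and>
      ints s' ''b'' (int r) 0 = 1 \<and> ints s' ''b'' (int (N + r)) 0 = - 1 \<and>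
      (\<forall>c\<in>{1..N}. ints s' ''A'' (int r) (int c) = row_coeff s (int r) (int c) \<and>
         ints s' ''A'' (int (N + r)) (int c) = - slot_coeff s (int r) (int c)) \<and>
      (\<forall>i. i \<noteq> int r \<longrightarrow> i \<noteq> int (N + r) \<longrightarrow>
        ints s' ''A'' i = ints s ''A'' i \<and> ints s' ''b'' i = ints s ''b'' i \<and>
        reals s' ''c'' i = reals s ''c'' i))"
      using M
      by (elim runs_mono) (auto simp: Mid_def agree_off_def upd_def fun_eq_iff)
  qed
qed

lemma runs_fill_rows:
  assumes "ints s ''N'' 0 0 = int N" "ints s ''r'' 0 0 = 0"
  shows "runs (WhileLess (scalar ''r'') (scalar ''N'') (Then (incr ''r'') fill_row)) s
    (N * (N * 20 + 7) + 1)
    (\<lambda>s'. agree_off {''A'', ''b'', ''q'', ''r''} (ints s) (ints s') \<and> (\<forall>i\<in>{1..N}.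
      reals s' ''c'' (int i) 0 = reals s ''v'' (ints s ''I'' (int i) 0) (ints s ''J'' (int i) 0) \<and>
      ints s' ''b'' (int i) 0 = 1 \<and> ints s' ''b'' (int (N + i)) 0 = - 1 \<and>
      (\<forall>c\<in>{1..N}. ints s' ''A'' (int i) (int c) = row_coeff s (int i) (int c) \<and>
         ints s' ''A'' (int (N + i)) (int c) = - slot_coeff s (int i) (int c))))"
proof -
  define Done where "Done s' i \<longleftrightarrow>
      reals s' ''c'' (int i) 0 = reals s ''v'' (ints s ''I'' (int i) 0) (ints s ''J'' (int i) 0) \<and>
      ints s' ''b'' (int i) 0 = 1 \<and> ints s' ''b'' (int (N + i)) 0 = - 1 \<and>
      (\<forall>c\<in>{1..N}. ints s' ''A'' (int i) (int c) = row_coeff s (int i) (int c) \<and>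
         ints s' ''A'' (int (N + i)) (int c) = - slot_coeff s (int i) (int c))" for s' :: store and i
  define Inv where "Inv m s' \<longleftrightarrow> ints s' ''r'' 0 0 = int m \<and>
      agree_off {''A'', ''b'', ''q'', ''r''} (ints s) (ints s') \<and> reals s' ''v'' = reals s ''v'' \<and>
      (\<forall>i\<in>{1..m}. Done s' i)" for m and s' :: store
  have "runs (WhileLess (scalar ''r'') (scalar ''N'') (Then (incr ''r'') fill_row)) s
      (N * Suc (1 + (4 + (N * 20 + 1))) + 1) (Inv N)"
  proof (rule runs_WhileLess)
    show "Inv 0 s" using assms by (simp add: Inv_def)
  next
    fix m s' assume m: "m < N" and I: "Inv m s'"
    show "runs (Then (incr ''r'') fill_row) s' (1 + (4 + (N * 20 + 1))) (Inv (Suc m))"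
    proof (rule runs_Then)
      show "runs (incr ''r'') s' 1 (\<lambda>t. t = result (incr ''r'') s')"
        by (rule runs_loop_free) simp_all
    next
      fix t assume t: "t = result (incr ''r'') s'"
      have agree: "agree_off {''A'', ''b'', ''q'', ''r''} (ints s) (ints t)"
        and tv: "reals t ''v'' = reals s ''v''"
        using I unfolding t Inv_def by simp_all
      have tr: "ints t ''r'' 0 0 = int (Suc m)"
        using I unfolding t Inv_def by (simp add: upd_apply)
      have tN: "ints t ''N'' 0 0 = int N"
        using agree_offD[OF agree, of "''N''"] assms by simp
      have IJ: "ints t ''I'' = ints s ''I''" "ints t ''J'' = ints s ''J''"
        using agree_offD[OF agree] by simp_all
      have coeffs: "row_coeff t = row_coeff s" "slot_coeff t = slot_coeff s"
        using agree by (rule row_coeff_cong, simp)+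
      have old: "ints t ''A'' = ints s' ''A''" "ints t ''b'' = ints s' ''b''" "reals t = reals s'"
        unfolding t by (simp_all add: upd_other)
      show "runs fill_row t (4 + (N * 20 + 1)) (Inv (Suc m))"
      proof (rule runs_mono[OF runs_fill_row[OF tN tr]])
        show "0 < N" using m by simp
      next
        fix u :: store
        assume u: "agree_off {''A'', ''b'', ''q''} (ints t) (ints u) \<and> reals u ''v'' = reals t ''v'' \<and>
          reals u ''c'' (int (Suc m)) 0 =
            reals t ''v'' (ints t ''I'' (int (Suc m)) 0) (ints t ''J'' (int (Suc m)) 0) \<and>
          ints u ''b'' (int (Suc m)) 0 = 1 \<and> ints u ''b'' (int (N + Suc m)) 0 = - 1 \<and>
          (\<forall>c\<in>{1..N}. ints u ''A'' (int (Suc m)) (int c) = row_coeff t (int (Suc m)) (int c) \<and>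
             ints u ''A'' (int (N + Suc m)) (int c) = - slot_coeff t (int (Suc m)) (int c)) \<and>
          (\<forall>i. i \<noteq> int (Suc m) \<longrightarrow> i \<noteq> int (N + Suc m) \<longrightarrow>
            ints u ''A'' i = ints t ''A'' i \<and> ints u ''b'' i = ints t ''b'' i \<and>
            reals u ''c'' i = reals t ''c'' i)"
        have new: "Done u (Suc m)"
          unfolding Done_def using u unfolding tv IJ coeffs by blast
        have "Done u i" if i: "i \<in> {1..m}" for i
        proof -
          \<comment> \<open>The current round touches rows \<open>Suc m\<close> and
            \<open>N + Suc m\<close>; since \<open>i \<le> m < N\<close>, the finished rows
            \<open>i\<close> and \<open>N + i\<close> avoid both.\<close>
          have ne: "int i \<noteq> int (Suc m)" "int i \<noteq> int (N + Suc m)"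
            "int (N + i) \<noteq> int (Suc m)" "int (N + i) \<noteq> int (N + Suc m)"
            using i m by auto
          have "ints u ''A'' (int i) = ints s' ''A'' (int i)" "ints u ''b'' (int i) = ints s' ''b'' (int i)"
            "reals u ''c'' (int i) = reals s' ''c'' (int i)"
            "ints u ''A'' (int (N + i)) = ints s' ''A'' (int (N + i))"
            "ints u ''b'' (int (N + i)) = ints s' ''b'' (int (N + i))"
            using u ne unfolding old by blast+
          moreover have "Done s' i" using I i unfolding Inv_def by blast
          ultimately show ?thesis unfolding Done_def by simp
        qed
        with new have "\<forall>i\<in>{1..Suc m}. Done u i"
          by (simp add: atLeastAtMostSuc_conv)
        moreover have "ints u ''r'' 0 0 = int (Suc m)"
          using u tr agree_offD[of "{''A'', ''b'', ''q''}" "ints t" "ints u" "''r''"] by simp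
        moreover have "agree_off {''A'', ''b'', ''q'', ''r''} (ints s) (ints u)"
          using u agree unfolding agree_off_def by (metis insert_iff)
        ultimately show "Inv (Suc m) u"
          unfolding Inv_def using u tv by simp
      qed simp
    qed
  next
    fix m s' assume "Inv m s'"
    then show "aval (scalar ''r'') s' < aval (scalar ''N'') s' \<longleftrightarrow> m < N"
      using assms agree_offD[of "{''A'', ''b'', ''q'', ''r''}" "ints s" "ints s'" "''N''"] by (simp add: Inv_def)
  qed
  then show ?thesis
    by (rule runs_mono) (simp_all add: Inv_def Done_def)
qed

section \<open>Decoding a solution\<close>

definition decode_plan :: com where
  "decode_plan =
    Then index_cols
    (Then (Set_scalar ''h'' (Const 0))
    (WhileLess (scalar ''h'') (scalar ''N'')
      (Then (incr ''h'')
        (Assign ''psi'' (vec ''I'' (scalar ''h'')) (vec ''J'' (scalar ''h'')) (vec ''x'' (scalar ''h''))))))"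

text \<open>Every variable is written to the cell of its target and slot. Slot 0 is written as well,
  but \<open>plan_of_store\<close> reads only sensor indices, which start at 1.\<close>

lemma runs_decode_plan:
  assumes "ints s ''n'' 0 0 = int n" "ints s ''k'' 0 0 = int k"
    "ints s ''h'' 0 0 = 0" "ints s ''N'' 0 0 = 0" "ints s ''I'' 0 0 = 0"
  shows "runs decode_plan s (n * 3 + 1 + (2 + (n * Suc k * 7 + 1)) + (1 + (n * Suc k * 3 + 1)))
    (\<lambda>s'. \<forall>c\<in>{1..n * Suc k}. ints s' ''psi'' (int (tgt k c)) (int (slot k c)) = ints s ''x'' (int c) 0)"
  unfolding decode_plan_def
proof (intro runs_Then)
  show "runs index_cols s (n * 3 + 1 + (2 + (n * Suc k * 7 + 1)))
    (\<lambda>s'. indexed n k s' \<and> agree_off {''h'', ''N'', ''I'', ''J''} (ints s) (ints s') \<and> reals s' = reals s)"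
    using assms by (rule runs_index_cols)
next
  fix s1
  assume s1: "indexed n k s1 \<and> agree_off {''h'', ''N'', ''I'', ''J''} (ints s) (ints s1) \<and> reals s1 = reals s"
  have x: "ints s1 ''x'' = ints s ''x''"
    using agree_offD[OF conjunct1[OF conjunct2[OF s1]]] by simp
  define Inv where "Inv m s' \<longleftrightarrow> ints s' ''h'' 0 0 = int m \<and>
      agree_off {''h'', ''psi''} (ints s1) (ints s') \<and>
      (\<forall>c\<in>{1..m}. ints s' ''psi'' (int (tgt k c)) (int (slot k c)) = ints s ''x'' (int c) 0)"
    for m and s' :: store
  show "runs (Set_scalar ''h'' (Const 0)) s1 1 (Inv 0)"
    by (rule runs_loop_free) (simp_all add: Inv_def upd_apply)
  fix s2 assume "Inv 0 s2"
  then have "runs (WhileLess (scalar ''h'') (scalar ''N'')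
      (Then (incr ''h'')
        (Assign ''psi'' (vec ''I'' (scalar ''h'')) (vec ''J'' (scalar ''h'')) (vec ''x'' (scalar ''h'')))))
      s2 (n * Suc k * Suc 2 + 1) (Inv (n * Suc k))"
    (is "runs (WhileLess _ _ ?c) _ _ _")
  proof (rule runs_WhileLess)
    fix m s' assume m: "m < n * Suc k" and I: "Inv m s'"
    have same: "ints s' a = ints s1 a" if "a \<notin> {''h'', ''psi''}" for a
      using I by (intro agree_offD[OF _ that]) (simp add: Inv_def)
    have IJ: "ints s' ''I'' (int (Suc m)) 0 = int (tgt k (Suc m))"
      "ints s' ''J'' (int (Suc m)) 0 = int (slot k (Suc m))"
      using s1 m by (simp_all add: same indexed_def Suc_le_eq del: of_nat_Suc mult_Suc_right)
    have h: "ints s' ''h'' 0 0 + 1 = int (Suc m)"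
      using I unfolding Inv_def by simp
    \<comment> \<open>A column is determined by its target and slot, so the new write does not
      overwrite an earlier one.\<close>
    have ne: "\<not> (tgt k c = tgt k (Suc m) \<and> slot k c = slot k (Suc m))" if "c \<in> {1..m}" for c
      using col_tgt_slot[of c k] col_tgt_slot[of "Suc m" k] that by auto
    have r: "result ?c s' = s'\<lparr>ints := upd (upd (ints s') ''h'' 0 0 (int (Suc m)))
        ''psi'' (int (tgt k (Suc m))) (int (slot k (Suc m))) (ints s ''x'' (int (Suc m)) 0)\<rparr>"
      using same[of "''x''"] x by (simp add: upd_apply h IJ del: of_nat_Suc)
    have "Inv (Suc m) (result ?c s')"
      using I unfolding r Inv_def
      by (simp add: upd_apply atLeastAtMostSuc_conv del: of_nat_Suc) (use ne in fastforce)
    then show "runs ?c s' 2 (Inv (Suc m))"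
      by (intro runs_loop_free) simp_all
  next
    fix m s' assume "Inv m s'"
    then have "ints s' ''h'' 0 0 = int m" "ints s' ''N'' 0 0 = int (n * Suc k)"
      using s1 agree_offD[of "{''h'', ''psi''}" "ints s1" "ints s'" "''N''"] unfolding Inv_def indexed_def by simp_all
    then show "aval (scalar ''h'') s' < aval (scalar ''N'') s' \<longleftrightarrow> m < n * Suc k"
      by (simp only: aval.simps of_nat_less_iff)
  qed
  then show "runs (WhileLess (scalar ''h'') (scalar ''N'') ?c) s2 (n * Suc k * 3 + 1)
    (\<lambda>s'. \<forall>c\<in>{1..n * Suc k}. ints s' ''psi'' (int (tgt k c)) (int (slot k c)) = ints s ''x'' (int c) 0)"
    by (rule runs_mono) (simp_all add: Inv_def)
qed

section \<open>The two programs on the input of a given instance\<close>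

context
  fixes G :: esg and \<sigma> :: "nat \<Rightarrow> nat"
begin

private abbreviation (input) "n \<equiv> num_targets G"
private abbreviation (input) "k \<equiv> num_sensors G"

lemma target_of_col: "c \<in> {1..n * Suc k} \<Longrightarrow> tgt k c \<in> targets G"
  unfolding targets_def by (rule tgt_in)

lemma sensor_of_col: "slot k c \<noteq> 0 \<Longrightarrow> slot k c \<in> sensors G"
  using slot_le[of k c] by (simp add: sensors_def)

text \<open>The work arrays have names different from the input arrays, so they start at zero and
  the input survives every phase. The dominant cost is a constant number of steps for each pair of
  row and column.\<close>

lemma runs_build_ilp:
  "runs build_ilp (instance_store G \<sigma>)
    (n * 3 + 1 + (2 + (n * Suc k * 7 + 1)) + (5 + (n * Suc k * (n * Suc k * 20 + 7) + 1)))
    (\<lambda>s. slot_ilp G \<sigma> (ilp_of_store s))"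
  unfolding build_ilp_def
proof (intro runs_Then)
  let ?s0 = "instance_store G \<sigma>" and ?N = "n * Suc k"
  show "runs index_cols ?s0 (n * 3 + 1 + (2 + (n * Suc k * 7 + 1)))
    (\<lambda>s'. indexed n k s' \<and> agree_off {''h'', ''N'', ''I'', ''J''} (ints ?s0) (ints s') \<and> reals s' = reals ?s0)"
    by (rule runs_index_cols) (simp_all add: instance_store_def)
  fix s1
  assume s1: "indexed n k s1 \<and> agree_off {''h'', ''N'', ''I'', ''J''} (ints ?s0) (ints s1) \<and> reals s1 = reals ?s0"
  have in1: "ints s1 a = ints ?s0 a" if "a \<notin> {''h'', ''N'', ''I'', ''J''}" for a
    using s1 by (intro agree_offD[OF _ that]) simp
  define Prep where "Prep s \<longleftrightarrow> agree_off {''T'', ''M''} (ints s1) (ints s) \<and> reals s = reals ?s0 \<and>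
    ints s ''T'' 0 0 = window G \<and> ints s ''M'' 0 0 = int (?N + ?N)" for s :: store
  show "runs (Then (Set_scalar ''T'' (scalar ''tau''))
      (Then (Set_scalar ''M'' (Add (scalar ''N'') (scalar ''N'')))
        (IfLess (scalar ''tau'') (Const 0) (Set_scalar ''T'' (scalar ''n'')) Skip))) s1 5 Prep"
  proof (rule runs_loop_free)
    have "ints s1 ''tau'' 0 0 = (case recharge G of enat \<tau> \<Rightarrow> int \<tau> | \<infinity> \<Rightarrow> - 1)"
      "ints s1 ''n'' 0 0 = int n" "ints s1 ''N'' 0 0 = int ?N"
      using in1[of "''tau''"] in1[of "''n''"] s1 by (simp_all add: instance_store_def indexed_def)
    then show "Prep (result (Then (Set_scalar ''T'' (scalar ''tau''))
      (Then (Set_scalar ''M'' (Add (scalar ''N'') (scalar ''N'')))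
        (IfLess (scalar ''tau'') (Const 0) (Set_scalar ''T'' (scalar ''n'')) Skip))) s1)"
      using s1 by (cases "recharge G") (simp_all add: Prep_def upd_apply window_def)
  qed simp_all
  fix s assume s: "Prep s"
  have same: "ints s a = ints s1 a" if "a \<notin> {''T'', ''M''}" for a
    using s by (intro agree_offD[OF _ that]) (simp add: Prep_def)
  have N: "ints s ''N'' 0 0 = int ?N"
    using s1 same[of "''N''"] by (simp add: indexed_def)
  have r: "ints s ''r'' 0 0 = 0"
    using same[of "''r''"] in1[of "''r''"] by (simp add: instance_store_def)
  have IJ: "ints s ''I'' (int c) 0 = int (tgt k c)" "ints s ''J'' (int c) 0 = int (slot k c)" if "c \<in> {1..?N}" for c
    using s1 that same[of "''I''"] same[of "''J''"] by (simp_all add: indexed_def del: mult_Suc_right)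
  have sigma: "ints s ''sigma'' (int i) 0 = int (\<sigma> i)" if "i \<in> targets G" for i
    using that same[of "''sigma''"] in1[of "''sigma''"] by (simp add: instance_store_def)
  have D: "ints s ''D'' (int i) (int j) = int (sensing G i j)" if "i \<in> targets G" "j \<in> sensors G" for i j
    using that same[of "''D''"] in1[of "''D''"] by (simp add: instance_store_def)
  have v: "reals s ''v'' (int i) (int j) = (if j = 0 then target_value G i else 0)" if "i \<in> targets G" for i j
    using that s by (simp add: Prep_def instance_store_def)
  have coeffs: "row_coeff s (int i) (int c) = window_coeff G \<sigma> (tgt k i) (slot k i) (tgt k c) (slot k c)"
    "slot_coeff s (int i) (int c) = of_bool (tgt k c = tgt k i)"
    if i: "i \<in> {1..?N}" and c: "c \<in> {1..?N}" for i c
  proof -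
    show 1: "slot_coeff s (int i) (int c) = of_bool (tgt k c = tgt k i)"
      using IJ[OF i] IJ[OF c] by (simp add: slot_coeff_def)
    show "row_coeff s (int i) (int c) = window_coeff G \<sigma> (tgt k i) (slot k i) (tgt k c) (slot k c)"
    proof (cases "slot k i = 0")
      case True
      then show ?thesis using IJ[OF i] 1 by (simp add: row_coeff_def window_coeff_def)
    next
      case False
      have T: "ints s ''T'' 0 0 = window G" using s by (simp add: Prep_def)
      \<comment> \<open>The input \<open>D\<close> is filled only at sensor indices, hence the case
        of a nonzero slot. A coefficient that reads \<open>D\<close> has equal slots in row and
        column, so the slot of the row may stand for that of the column.\<close>
      have "ints s ''D'' (int (tgt k c)) (int (slot k i)) = int (sensing G (tgt k c) (slot k i))"
        using D target_of_col[OF c] sensor_of_col[OF False] .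
      then show ?thesis
        using False IJ[OF i] IJ[OF c] T sigma[OF target_of_col[OF i]] sigma[OF target_of_col[OF c]]
        by (simp add: row_coeff_def window_coeff_def)
    qed
  qed
  show "runs (WhileLess (scalar ''r'') (scalar ''N'') (Then (incr ''r'') fill_row)) s
    (?N * (?N * 20 + 7) + 1) (\<lambda>s. slot_ilp G \<sigma> (ilp_of_store s))"
  proof (rule runs_mono[OF runs_fill_rows[OF N r]])
    fix t :: store
    assume t: "agree_off {''A'', ''b'', ''q'', ''r''} (ints s) (ints t) \<and> (\<forall>i\<in>{1..?N}.
      reals t ''c'' (int i) 0 = reals s ''v'' (ints s ''I'' (int i) 0) (ints s ''J'' (int i) 0) \<and>
      ints t ''b'' (int i) 0 = 1 \<and> ints t ''b'' (int (?N + i)) 0 = - 1 \<and>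
      (\<forall>c\<in>{1..?N}. ints t ''A'' (int i) (int c) = row_coeff s (int i) (int c) \<and>
         ints t ''A'' (int (?N + i)) (int c) = - slot_coeff s (int i) (int c)))"
    have "ints t ''N'' 0 0 = int ?N" "ints t ''M'' 0 0 = int (?N + ?N)"
      using agree_offD[OF conjunct1[OF t]] N s by (simp_all add: Prep_def)
    then have dims: "num_vars (ilp_of_store t) = ?N" "num_constrs (ilp_of_store t) = ?N + ?N"
      unfolding ilp_of_store_def by (simp_all only: ilp.simps nat_int)
    show "slot_ilp G \<sigma> (ilp_of_store t)"
      unfolding slot_ilp_def Let_def
    proof (intro conjI ballI)
      fix c assume c: "c \<in> {1..?N}"
      then have "reals t ''c'' (int c) 0 = reals s ''v'' (int (tgt k c)) (int (slot k c))"
        using t IJ[OF c] by simp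
      then show "obj (ilp_of_store t) c = (if slot k c = 0 then target_value G (tgt k c) else 0)"
        using v[OF target_of_col[OF c]] by (simp add: ilp_of_store_def)
    next
      fix i assume i: "i \<in> {1..?N}"
      then show "rhs (ilp_of_store t) i = 1" "rhs (ilp_of_store t) (?N + i) = - 1"
        using t unfolding ilp_of_store_def ilp.simps by blast+
      fix c assume c: "c \<in> {1..?N}"
      show "coeff (ilp_of_store t) i c = window_coeff G \<sigma> (tgt k i) (slot k i) (tgt k c) (slot k c)"
        using t i c coeffs(1)[OF i c] unfolding ilp_of_store_def ilp.simps by metis
      show "coeff (ilp_of_store t) (?N + i) c = - of_bool (tgt k c = tgt k i)"
        using t i c coeffs(2)[OF i c] unfolding ilp_of_store_def ilp.simps by metis
    qed (rule dims)+
  qed simp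
qed

lemma runs_decode_solution:
  assumes "num_vars P = n * Suc k"
  shows "runs decode_plan (solution_store G \<sigma> P x)
    (n * 3 + 1 + (2 + (n * Suc k * 7 + 1)) + (1 + (n * Suc k * 3 + 1)))
    (\<lambda>s. plan_of G x = plan_of_store G s)"
proof (rule runs_mono[OF runs_decode_plan])
  fix s :: store
  assume s: "\<forall>c\<in>{1..n * Suc k}. ints s ''psi'' (int (tgt k c)) (int (slot k c)) =
    ints (solution_store G \<sigma> P x) ''x'' (int c) 0"
  have "ints s ''psi'' (int i) (int j) = x (col k i j)" if "i \<in> targets G" "j \<in> sensors G" for i j
  proof -
    have ij: "i \<in> {1..n}" "j \<le> k" using that by (simp_all add: targets_def sensors_def)
    then have c: "col k i j \<in> {1..n * Suc k}" by (rule col_in)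
    then have "int (col k i j) \<in> int ` {1..num_vars P}" using assms by simp
    then have "ints (solution_store G \<sigma> P x) ''x'' (int (col k i j)) 0 = x (col k i j)"
      by (simp add: solution_store_def)
    then show ?thesis
      using s[rule_format, OF c] ij by (simp add: tgt_col slot_col)
  qed
  then show "plan_of G x = plan_of_store G s"
    unfolding plan_of_def plan_of_store_def by (auto intro!: restrict_ext)
qed (simp_all add: solution_store_def instance_store_def)

end

text \<open>With m = (1 + n + k)^2, each of n, 1 and N is at most m, so everything is bounded by a
  multiple of m^2. The first sum stays below 47 m^2; 60 is a round choice covering both
  programs.\<close>

lemma time_bound:
  fixes n k N :: nat
  assumes "N = n * Suc k"
  shows "n * 3 + 1 + (2 + (N * 7 + 1)) + (5 + (N * (N * 20 + 7) + 1)) \<le> 60 * (1 + (n + k)) ^ 4"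
    "n * 3 + 1 + (2 + (N * 7 + 1)) + (1 + (N * 3 + 1)) \<le> 60 * (1 + (n + k)) ^ 4"
proof -
  define m where "m = (1 + (n + k)) * (1 + (n + k))"
  have m: "1 + (n + k) \<le> m"
    unfolding m_def by simp
  have N: "N \<le> m"
    unfolding m_def assms by (intro mult_le_mono) auto
  have mm: "m \<le> m * m"
    using m by (cases m) simp_all
  have NN: "N * N \<le> m * m"
    by (rule mult_le_mono[OF N N])
  have pow: "(1 + (n + k)) ^ 4 = m * m"
    unfolding m_def by (simp only: power4_eq_xxxx mult.assoc)
  have "N * (N * 20 + 7) = 20 * (N * N) + 7 * N"
    by (simp add: algebra_simps)
  then show "n * 3 + 1 + (2 + (N * 7 + 1)) + (5 + (N * (N * 20 + 7) + 1)) \<le> 60 * (1 + (n + k)) ^ 4"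
    unfolding pow using m N mm NN by linarith
  show "n * 3 + 1 + (2 + (N * 7 + 1)) + (1 + (N * 3 + 1)) \<le> 60 * (1 + (n + k)) ^ 4"
    unfolding pow using m N mm by linarith
qed

theorem proposition3:
  shows "\<exists>(build :: com) (decode :: com) (p :: nat poly) (C :: nat).
    \<forall>(G :: esg) (\<sigma> :: nat \<Rightarrow> nat). valid_esg G \<longrightarrow> target_ordering G \<sigma> \<longrightarrow>
      (\<exists>P dec.
         constructs_ilp build p G \<sigma> P \<and>
         computes_decoding decode p G \<sigma> P dec \<and>
         encodes_best_red_response P dec G \<sigma> \<and>
         num_vars P \<le> C * (max 1 (num_targets G) * max 1 (num_sensors G)) \<and>
         num_constrs P \<le> C * (max 1 (num_targets G) * max 1 (num_sensors G)))"
proof -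
  \<comment> \<open>The polynomial \<open>[:1, 1:]\<close> is 1 + X.\<close>
  obtain p :: "nat poly" where p: "poly p m = 60 * (1 + m) ^ 4" for m
    using that[of "smult 60 ([:1, 1:] ^ 4)"] by simp
  show ?thesis
  proof (rule exI[of _ build_ilp], rule exI[of _ decode_plan], rule exI[of _ p], rule exI[of _ 4],
      intro allI impI)
    fix G :: esg and \<sigma> :: "nat \<Rightarrow> nat"
    assume G: "valid_esg G" "target_ordering G \<sigma>"
    let ?n = "num_targets G" and ?k = "num_sensors G"
    have "runs build_ilp (instance_store G \<sigma>) (poly p (?n + ?k)) (\<lambda>s. slot_ilp G \<sigma> (ilp_of_store s))"
      unfolding p by (rule runs_mono[OF runs_build_ilp time_bound(1)[OF refl]])
    then obtain t s where build: "exec build_ilp (instance_store G \<sigma>) t s"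
      "t \<le> poly p (?n + ?k)" "slot_ilp G \<sigma> (ilp_of_store s)"
      unfolding runs_def by blast
    define P where "P = ilp_of_store s"
    have dims: "num_vars P = ?n * Suc ?k" "num_constrs P = ?n * Suc ?k + ?n * Suc ?k"
      using build(3) unfolding slot_ilp_def P_def Let_def by blast+
    have "?n * Suc ?k \<le> 2 * (max 1 ?n * max 1 ?k)"
    proof -
      \<comment> \<open>One extra slot at most doubles \<open>max 1 ?k\<close>, which also covers an
        instance without sensors. Having two rows per column doubles the bound again, whence the
        constant 4.\<close>
      have "?n * Suc ?k \<le> max 1 ?n * (2 * max 1 ?k)"
        by (intro mult_le_mono) auto
      then show ?thesis by simp
    qed
    then have "num_vars P \<le> 4 * (max 1 ?n * max 1 ?k)" "num_constrs P \<le> 4 * (max 1 ?n * max 1 ?k)"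
      unfolding dims by linarith+
    moreover have "constructs_ilp build_ilp p G \<sigma> P"
      unfolding constructs_ilp_def P_def using build by blast
    moreover have "computes_decoding decode_plan p G \<sigma> P (plan_of G)"
      unfolding computes_decoding_def
    proof (intro allI impI)
      fix x
      have "runs decode_plan (solution_store G \<sigma> P x) (poly p (?n + ?k)) (\<lambda>s. plan_of G x = plan_of_store G s)"
        unfolding p by (rule runs_mono[OF runs_decode_solution[OF dims(1)] time_bound(2)[OF refl]])
      then show "\<exists>t s. exec decode_plan (solution_store G \<sigma> P x) t s \<and> t \<le> poly p (?n + ?k) \<and>
          plan_of G x = plan_of_store G s"
        unfolding runs_def .
    qed
    moreover have "encodes_best_red_response P (plan_of G) G \<sigma>"
      by (rule slot_formulation.encodes) (use G build(3) in \<open>simp add: slot_formulation_def P_def\<close>)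
    ultimately show "\<exists>P dec. constructs_ilp build_ilp p G \<sigma> P \<and>
        computes_decoding decode_plan p G \<sigma> P dec \<and> encodes_best_red_response P dec G \<sigma> \<and>
        num_vars P \<le> 4 * (max 1 ?n * max 1 ?k) \<and> num_constrs P \<le> 4 * (max 1 ?n * max 1 ?k)"
      by blast
  qed
qed

end
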